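(* Let $(\mathbb X,\mathrm{dist}_{\mathbb X})$ be a compact Ahlfors $d$-regular length space with $d>1$, and let $K\colon\mathbb X\times\mathbb X\to\mathbb R$ be a continuous, symmetric, positive definite kernel. Then there is a constant $c>0$, depending only on $\mathbb X$ and $K$, such that for every $\mu\in\mathcal P(\mathbb X)$ and every $L\ge 1$, $$\min_{\nu\in\mathcal P^{\mathrm{curve}}_L(\mathbb X)}\mathscr D_K(\mu,\nu)\le c\,L^{-\frac{d}{2d-2}}.$$
   Context: $\mathbb X$ is a compact metric space with a finite nonnegative Borel measure $\sigma_{\mathbb X}$ with $\mathrm{supp}(\sigma_{\mathbb X})=\mathbb X$. It is Ahlfors $d$-regular if $\sigma_{\mathbb X}(B_r(x))\sim r^d$ for all $x\in\mathbb X$ and $0<r\le\mathrm{diam}(\mathbb X)$, where $B_r(x)=\{y:\mathrm{dist}_{\mathbb X}(x,y)\le r\}$ and the constants in $\sim$ do not depend on $x,r$. It is a length space if $\mathrm{dist}_{\mathbb X}(x,y)$ equals the infimum of lengths of continuous curves joining $x$ and $y$. $\mathcal P(\mathbb X)$ denotes the Borel probability measures on $\mathbb X$. For a continuous symmetric positive definite kernel $K$ with reproducing kernel Hilbert space $H_K(\mathbb X)$, the discrepancy is $\mathscr D_K(\mu,\nu)=\sup_{\|\varphi\|_{H_K(\mathbb X)}\le1}\left|\int_{\mathbb X}\varphi\,d(\mu-\nu)\right|$, equivalently $\mathscr D_K^2(\mu,\nu)=\iint K\,d\mu\,d\mu-2\iint K\,d\mu\,d\nu+\iint K\,d\nu\,d\nu$.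 A closed curve is a continuous $\gamma\colon[a,b]\to\mathbb X$ with $\gamma(a)=\gamma(b)$; its length is $\ell(\gamma)=\sup\{\sum_{k=1}^n\mathrm{dist}_{\mathbb X}(\gamma(t_k),\gamma(t_{k-1})): a\le t_0\le\dots\le t_n\le b,\ n\in\mathbb N\}$. $\mathcal P^{\mathrm{curve}}_L(\mathbb X)$ is the set of $\nu\in\mathcal P(\mathbb X)$ for which there is a closed curve $\gamma\colon[a,b]\to\mathbb X$ with $\mathrm{supp}(\nu)\subset\gamma([a,b])$ and $\ell(\gamma)\le L$. *)

theory Defs
  imports "HOL-Probability.Probability"
begin

definition curve_length :: "(real \<Rightarrow> 'a::metric_space) \<Rightarrow> real \<Rightarrow> real \<Rightarrow> ereal" where
  "curve_length \<gamma> a b =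
     Sup {ereal (\<Sum>k\<in>{1..n}. dist (\<gamma> (t k)) (\<gamma> (t (k - 1)))) | n t.
            a \<le> t 0 \<and> (\<forall>k<n. t k \<le> t (Suc k)) \<and> t n \<le> b}"

definition measure_support :: "'a::metric_space measure \<Rightarrow> 'a set" where
  "measure_support \<nu> = {x. \<forall>r>0. emeasure \<nu> (ball x r) > 0}"

definition borel_prob :: "'a::metric_space measure \<Rightarrow> bool" where
  "borel_prob \<mu> \<longleftrightarrow> prob_space \<mu> \<and> sets \<mu> = sets borel"

definition ahlfors_regular :: "'a::metric_space measure \<Rightarrow> real \<Rightarrow> bool" where
  "ahlfors_regular \<sigma> d \<longleftrightarrow> (\<exists>C1 C2. 0 < C1 \<and> 0 < C2 \<and>
     (\<forall>x r. 0 < r \<and> r \<le> diameter (UNIV :: 'a set) \<longrightarrow>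
        C1 * r powr d \<le> measure \<sigma> (cball x r) \<and> measure \<sigma> (cball x r) \<le> C2 * r powr d))"

definition length_space :: "'a::metric_space itself \<Rightarrow> bool" where
  "length_space _ \<longleftrightarrow> (\<forall>x y::'a. ereal (dist x y) =
     Inf {curve_length \<gamma> a b | \<gamma> a b. a \<le> b \<and> continuous_on {a..b} \<gamma> \<and> \<gamma> a = x \<and> \<gamma> b = y})"

definition pos_def_kernel :: "('a \<Rightarrow> 'a \<Rightarrow> real) \<Rightarrow> bool" where
  "pos_def_kernel K \<longleftrightarrow> (\<forall>x y. K x y = K y x) \<and>
     (\<forall>n (p :: nat \<Rightarrow> 'a) (c :: nat \<Rightarrow> real).
        0 \<le> (\<Sum>i<n. \<Sum>j<n. c i * c j * K (p i) (p j)))"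

definition discrepancy :: "('a \<Rightarrow> 'a \<Rightarrow> real) \<Rightarrow> 'a measure \<Rightarrow> 'a measure \<Rightarrow> real" where
  "discrepancy K \<mu> \<nu> = sqrt
     ((\<integral>x. (\<integral>y. K x y \<partial>\<mu>) \<partial>\<mu>) - 2 * (\<integral>x. (\<integral>y. K x y \<partial>\<nu>) \<partial>\<mu>)
       + (\<integral>x. (\<integral>y. K x y \<partial>\<nu>) \<partial>\<nu>))"

definition curve_measures :: "real \<Rightarrow> 'a::metric_space measure set" where
  "curve_measures L = {\<nu>. borel_prob \<nu> \<and>
     (\<exists>\<gamma> a b. a \<le> b \<and> continuous_on {a..b} \<gamma> \<and> \<gamma> a = \<gamma> b \<and>
        measure_support \<nu> \<subseteq> \<gamma> ` {a..b} \<and> curve_length \<gamma> a b \<le> ereal L)}"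

end

theory Submission
  imports Defs
begin

text \<open>Every closed curve of length at most \<open>L\<close> has a 1-Lipschitz parametrization on \<open>[0, L]\<close>.
  Existence of the minimum is a compactness argument: lift the measures of a minimizing sequence to the
  parameter interval, extract a weakly convergent subsequence of the lifts (Helly) and a pointwise convergent
  subsequence of the parametrizations, and pass to the limit in the discrepancy.

  For the rate, choosing points greedily yields for every \<open>N\<close> an empirical measure of \<open>N\<close> points
  with discrepancy \<open>O(N powr (-1/2))\<close> to \<open>\<mu>\<close>. By Ahlfors regularity some two among any \<open>k\<close> points have distance
  \<open>O(k powr (-1/d))\<close>, so adding points one by one as detours gives a closed curve through
  the \<open>N\<close> points of length \<open>O(\<Sum>k\<le>N. k powr (-1/d)) = O(N powr (1 - 1/d))\<close>. Solving \<open>L = N powr (1 - 1/d)\<close>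
  for \<open>N\<close> turns \<open>N powr (-1/2)\<close> into \<open>L powr (-d/(2d-2))\<close>.\<close>

subsection \<open>Lipschitz parametrization of curves\<close>

lemma curve_length_le_iff:
  "curve_length \<gamma> a b \<le> ereal L \<longleftrightarrow>
     (\<forall>n t. a \<le> t 0 \<and> (\<forall>k<n. t k \<le> t (Suc k)) \<and> t n \<le> b \<longrightarrow>
        (\<Sum>k\<in>{1..n}. dist (\<gamma> (t k)) (\<gamma> (t (k - 1)))) \<le> L)"
proof -
  have "curve_length \<gamma> a b \<le> ereal L \<longleftrightarrow>
      (\<forall>x\<in>{ereal (\<Sum>k\<in>{1..n}. dist (\<gamma> (t k)) (\<gamma> (t (k - 1)))) | n t.
            a \<le> t 0 \<and> (\<forall>k<n. t k \<le> t (Suc k)) \<and> t n \<le> b}. x \<le> ereal L)"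
    unfolding curve_length_def Sup_le_iff ..
  also have "\<dots> \<longleftrightarrow> (\<forall>n t. a \<le> t 0 \<and> (\<forall>k<n. t k \<le> t (Suc k)) \<and> t n \<le> b \<longrightarrow>
        ereal (\<Sum>k\<in>{1..n}. dist (\<gamma> (t k)) (\<gamma> (t (k - 1)))) \<le> ereal L)"
    by blast
  finally show ?thesis unfolding ereal_less_eq .
qed

lemma steps_mono:
  fixes t :: "nat \<Rightarrow> real"
  assumes "\<And>k. k < n \<Longrightarrow> t k \<le> t (Suc k)" "i \<le> j" "j \<le> n"
  shows "t i \<le> t j"
  using assms(2,3)
proof (induction j rule: dec_induct)
  case (step m)
  then show ?case using assms(1)[of m] by simp
qed simp

text \<open>Each chord is at most the parameter increment it spans, and the increments telescope to
  \<open>t n - t 0\<close>.\<close>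

lemma lipschitz_curve_length:
  assumes "1-lipschitz_on {0..l} g" "0 \<le> l"
  shows "curve_length g 0 l \<le> ereal l"
  unfolding curve_length_le_iff
proof (intro allI impI, elim conjE)
  fix n :: nat and t :: "nat \<Rightarrow> real"
  assume t: "0 \<le> t 0" "\<forall>k<n. t k \<le> t (Suc k)" "t n \<le> l"
  have in_range: "t k \<in> {0..l}" if "k \<le> n" for k
    using steps_mono[of n t 0 k] steps_mono[of n t k n] that t by auto
  have "(\<Sum>k\<in>{1..n}. dist (g (t k)) (g (t (k - 1)))) = (\<Sum>k<n. dist (g (t (Suc k))) (g (t k)))"
    by (rule sum.reindex_bij_witness[of _ Suc "\<lambda>k. k - 1"]) auto
  also have "\<dots> \<le> (\<Sum>k<n. t (Suc k) - t k)"
  proof (rule sum_mono)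
    fix k assume "k \<in> {..<n}"
    then show "dist (g (t (Suc k))) (g (t k)) \<le> t (Suc k) - t k"
      using lipschitz_onD[OF assms(1) in_range[of "Suc k"] in_range[of k]] t(2)
      by (simp add: dist_real_def)
  qed
  also have "\<dots> = t n - t 0"
    by (simp add: sum_lessThan_telescope)
  finally show "(\<Sum>k\<in>{1..n}. dist (g (t k)) (g (t (k - 1)))) \<le> l"
    using t by simp
qed

section \<open>Arc length as a real function of the endpoint\<close>

definition chord_sums :: "(real \<Rightarrow> 'a::metric_space) \<Rightarrow> real \<Rightarrow> real \<Rightarrow> real set" where
  "chord_sums \<gamma> a b = {(\<Sum>k\<in>{1..n}. dist (\<gamma> (t k)) (\<gamma> (t (k - 1)))) | n t.
            a \<le> t 0 \<and> (\<forall>k<n. t k \<le> t (Suc k)) \<and> t n \<le> b}"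

text \<open>Real-valued, so that arc lengths can be subtracted. The real \<open>Sup\<close> is
  informative only for sets bounded above; a finite bound on \<open>curve_length\<close> supplies
  this, and the degenerate interval from \<open>a\<close> to \<open>a\<close> is treated
  directly.\<close>

definition arc_length :: "(real \<Rightarrow> 'a::metric_space) \<Rightarrow> real \<Rightarrow> real \<Rightarrow> real" where
  "arc_length \<gamma> a b = Sup (chord_sums \<gamma> a b)"

lemma chord_sumsI:
  "a \<le> t 0 \<Longrightarrow> \<forall>k<n. t k \<le> t (Suc k) \<Longrightarrow> t n \<le> b \<Longrightarrow>
    (\<Sum>k\<in>{1..n}. dist (\<gamma> (t k)) (\<gamma> (t (k - 1)))) \<in> chord_sums \<gamma> a b"
  unfolding chord_sums_def by (intro CollectI exI[of _ n] exI[of _ t] conjI refl)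

lemma chord_sums_mono: "b \<le> c \<Longrightarrow> chord_sums \<gamma> a b \<subseteq> chord_sums \<gamma> a c"
  by (auto simp del: One_nat_def simp: chord_sums_def intro: order_trans)

lemma zero_in_chord_sums: "a \<le> b \<Longrightarrow> 0 \<in> chord_sums \<gamma> a b"
  using chord_sumsI[of a "\<lambda>_. a" 0 b \<gamma>] by simp

lemma chord_sums_le:
  assumes "curve_length \<gamma> a b \<le> ereal L" "x \<in> chord_sums \<gamma> a s" "s \<le> b"
  shows "x \<le> L"
proof -
  have "x \<in> chord_sums \<gamma> a b" using assms(2,3) chord_sums_mono by blast
  then obtain n t where t: "x = (\<Sum>k\<in>{1..n}. dist (\<gamma> (t k)) (\<gamma> (t (k - 1))))"
      "a \<le> t 0" "\<forall>k<n. t k \<le> t (Suc k)" "t n \<le> b" unfolding chord_sums_def by blast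
  then show ?thesis
    using assms(1)[unfolded curve_length_le_iff, rule_format, of t n] by simp
qed

lemma arc_length_bounds:
  assumes "curve_length \<gamma> a b \<le> ereal L" "a \<le> s" "s \<le> b"
  shows "0 \<le> arc_length \<gamma> a s" "arc_length \<gamma> a s \<le> L"
proof -
  have le: "x \<le> L" if "x \<in> chord_sums \<gamma> a s" for x
    using chord_sums_le[OF assms(1) that assms(3)] .
  have 0: "0 \<in> chord_sums \<gamma> a s" using zero_in_chord_sums assms(2) .
  show "0 \<le> arc_length \<gamma> a s"
    unfolding arc_length_def by (rule cSup_upper[OF 0 bdd_aboveI[of _ L]]) (rule le)
  show "arc_length \<gamma> a s \<le> L"
    unfolding arc_length_def by (rule cSup_least) (use 0 le in blast)+
qed

lemma arc_length_increment:
  assumes L: "curve_length \<gamma> a b \<le> ereal L" and "a \<le> s" "s \<le> u" "u \<le> b"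
  shows "arc_length \<gamma> a s + dist (\<gamma> s) (\<gamma> u) \<le> arc_length \<gamma> a u"
proof -
  have bdd: "bdd_above (chord_sums \<gamma> a u)"
    using chord_sums_le[OF L _ \<open>u \<le> b\<close>] by (rule bdd_aboveI)
  have ne: "chord_sums \<gamma> a s \<noteq> {}"
    using zero_in_chord_sums[OF \<open>a \<le> s\<close>] by blast
  have "Sup (chord_sums \<gamma> a s) \<le> arc_length \<gamma> a u - dist (\<gamma> s) (\<gamma> u)"
  proof (rule cSup_least[OF ne])
    fix x assume "x \<in> chord_sums \<gamma> a s"
    then obtain n t where x: "x = (\<Sum>k\<in>{1..n}. dist (\<gamma> (t k)) (\<gamma> (t (k - 1))))"
      and t: "a \<le> t 0" "\<forall>k<n. t k \<le> t (Suc k)" "t n \<le> s" unfolding chord_sums_def by blast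
    \<comment> \<open>A partition inside \<open>{a..s}\<close> need not reach \<open>s\<close>, so
      \<open>s\<close> is appended before \<open>u\<close>. The chord from \<open>t n\<close> to
      \<open>s\<close> is nonnegative and is dropped; the chord from \<open>s\<close> to
      \<open>u\<close> is the gain.\<close>
    define t' where "t' k = (if k \<le> n then t k else if k = Suc n then s else u)" for k
    have sum_t: "(\<Sum>k\<in>{1..n}. dist (\<gamma> (t' k)) (\<gamma> (t' (k - 1)))) = x"
      unfolding x by (rule sum.cong) (auto simp: t'_def)
    have "t' k \<le> t' (Suc k)" if k: "k < Suc (Suc n)" for k
    proof -
      consider "k < n" | "k = n" | "k = Suc n" using k by linarith
      then show ?thesis using t assms(3) by cases (auto simp: t'_def)
    qed
    then have "(\<Sum>k\<in>{1..Suc (Suc n)}. dist (\<gamma> (t' k)) (\<gamma> (t' (k - 1)))) \<in> chord_sums \<gamma> a u"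
      using t(1) by (intro chord_sumsI) (auto simp: t'_def)
    then have "(\<Sum>k\<in>{1..Suc (Suc n)}. dist (\<gamma> (t' k)) (\<gamma> (t' (k - 1)))) \<le> arc_length \<gamma> a u"
      unfolding arc_length_def by (rule cSup_upper[OF _ bdd])
    moreover have "(\<Sum>k\<in>{1..Suc (Suc n)}. dist (\<gamma> (t' k)) (\<gamma> (t' (k - 1)))) =
        (\<Sum>k\<in>{1..n}. dist (\<gamma> (t' k)) (\<gamma> (t' (k - 1)))) + dist (\<gamma> (t' (Suc n))) (\<gamma> (t' n)) +
        dist (\<gamma> (t' (Suc (Suc n)))) (\<gamma> (t' (Suc n)))"
      by simp
    moreover have "t' (Suc n) = s" "t' (Suc (Suc n)) = u" by (simp_all add: t'_def)
    ultimately show "x \<le> arc_length \<gamma> a u - dist (\<gamma> s) (\<gamma> u)"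
      using zero_le_dist[of "\<gamma> s" "\<gamma> (t' n)"] unfolding sum_t
      by (simp only: dist_commute[of "\<gamma> u"])
  qed
  then show ?thesis by (simp add: arc_length_def)
qed

lemma arc_length_refl: "arc_length \<gamma> a a = 0"
proof -
  have "chord_sums \<gamma> a a = {0}"
  proof (intro equalityI subsetI)
    fix x assume "x \<in> chord_sums \<gamma> a a"
    then obtain n t where x: "x = (\<Sum>k\<in>{1..n}. dist (\<gamma> (t k)) (\<gamma> (t (k - 1))))"
      and t: "a \<le> t 0" "\<forall>k<n. t k \<le> t (Suc k)" "t n \<le> a" unfolding chord_sums_def by blast
    have "t k = a" if "k \<le> n" for k
      using steps_mono[of n t 0 k] steps_mono[of n t k n] that t by fastforce
    then show "x \<in> {0}" unfolding x by (auto intro!: sum.neutral)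
  qed (simp add: zero_in_chord_sums)
  then show ?thesis by (simp add: arc_length_def)
qed

text \<open>The curve is composed with the right-continuous inverse \<open>\<tau>\<close> of its arc length. A jump of
  \<open>\<tau>\<close> is a parameter interval on which the curve is constant, and the Lipschitz bound needs only that
  the curve is continuous, so continuity of the arc length never has to be proved.\<close>
lemma lipschitz_reparametrization:
  fixes \<gamma> :: "real \<Rightarrow> 'a::metric_space"
  assumes "a \<le> b" and cont: "continuous_on {a..b} \<gamma>" and L: "curve_length \<gamma> a b \<le> ereal L"
  obtains g where "0 \<le> L" "1-lipschitz_on {0..L} g" "g 0 = \<gamma> a" "g L = \<gamma> b" "g ` {0..L} = \<gamma> ` {a..b}"
proof -
  define l where "l = arc_length \<gamma> a"
  have l_bounds: "0 \<le> l t" "l t \<le> L" if "t \<in> {a..b}" for t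
    using arc_length_bounds[OF L] that by (auto simp: l_def)
  have l_inc: "dist (\<gamma> s) (\<gamma> t) \<le> l t - l s" if "a \<le> s" "s \<le> t" "t \<le> b" for s t
    using arc_length_increment[OF L that] by (simp add: l_def)
  have l_mono: "l s \<le> l t" if "a \<le> s" "s \<le> t" "t \<le> b" for s t
    using l_inc[OF that] zero_le_dist[of "\<gamma> s" "\<gamma> t"] by linarith
  have la: "l a = 0" by (simp add: l_def arc_length_refl)
  define \<tau> where "\<tau> u = Sup {t\<in>{a..b}. l t \<le> u}" for u
  have bdd: "bdd_above {t\<in>{a..b}. l t \<le> u}" for u by (rule bdd_aboveI[of _ b]) auto
  have ne: "a \<in> {t\<in>{a..b}. l t \<le> u}" if "0 \<le> u" for u using la that assms by auto
  have \<tau>_range: "\<tau> u \<in> {a..b}" if "0 \<le> u" for u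
    using cSup_upper[OF ne[OF that] bdd] ne[OF that] cSup_least[of "{t\<in>{a..b}. l t \<le> u}" b]
    unfolding \<tau>_def by fastforce
  \<comment> \<open>Monotonicity of \<open>l\<close> controls it strictly beyond and strictly before
    \<open>\<tau> u\<close>, not at \<open>\<tau> u\<close> itself; hence the one-sided approach in
    the Lipschitz bound.\<close>
  have above: "u < l t" if "\<tau> u < t" "t \<le> b" "0 \<le> u" for t u
    using cSup_upper[OF _ bdd[of u], of t] that \<tau>_range[OF \<open>0 \<le> u\<close>] unfolding \<tau>_def by force
  have below: "l t \<le> u" if tu: "t < \<tau> u" "a \<le> t" "0 \<le> u" for t u
  proof -
    obtain t' where "t' \<in> {a..b}" "l t' \<le> u" "t < t'"
      using less_cSupD[of "{t\<in>{a..b}. l t \<le> u}" t] ne[OF \<open>0 \<le> u\<close>] tu(1)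
      unfolding \<tau>_def by blast
    then show ?thesis using l_mono[of t t'] tu by auto
  qed
  define g where "g u = \<gamma> (\<tau> u)" for u
  have \<tau>_mono: "\<tau> u \<le> \<tau> v" if "0 \<le> u" "u \<le> v" for u v
    unfolding \<tau>_def using ne[OF \<open>0 \<le> u\<close>] that by (intro cSup_subset_mono bdd) auto
  have lip: "dist (g u) (g v) \<le> v - u" if "0 \<le> u" "u \<le> v" for u v
  proof (cases "\<tau> u = \<tau> v")
    case True then show ?thesis using that by (simp add: g_def)
  next
    case False
    then have less: "\<tau> u < \<tau> v" using \<tau>_mono[OF that] by simp
    have in_range: "\<tau> u \<in> {a..b}" "\<tau> v \<in> {a..b}" using \<tau>_range that by auto
    show ?thesis
    proof (rule field_le_epsilon)
      fix e :: real assume "0 < e"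
      obtain d1 where d1: "d1 > 0" "\<And>t. t \<in> {a..b} \<Longrightarrow> dist t (\<tau> u) < d1 \<Longrightarrow> dist (\<gamma> t) (\<gamma> (\<tau> u)) < e / 2"
        using cont in_range(1) \<open>0 < e\<close> unfolding continuous_on_iff by (metis half_gt_zero)
      obtain d2 where d2: "d2 > 0" "\<And>t. t \<in> {a..b} \<Longrightarrow> dist t (\<tau> v) < d2 \<Longrightarrow> dist (\<gamma> t) (\<gamma> (\<tau> v)) < e / 2"
        using cont in_range(2) \<open>0 < e\<close> unfolding continuous_on_iff by (metis half_gt_zero)
      \<comment> \<open>Moving inward by \<open>h\<close> reaches points where \<open>above\<close>
        and \<open>below\<close> apply, so the arc length between them is at most
        \<open>v - u\<close>. Continuity of \<open>\<gamma>\<close> costs \<open>e / 2\<close> at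
        each end, and taking \<open>h\<close> below half the gap keeps the two points in
        order.\<close>
      obtain h where h: "0 < h" "h < d1" "h < d2" "h < (\<tau> v - \<tau> u) / 2"
        using field_lbound_gt_zero[of "min d1 d2" "(\<tau> v - \<tau> u) / 2"] d1(1) d2(1) less by auto
      have "dist (\<gamma> (\<tau> u + h)) (\<gamma> (\<tau> u)) < e / 2"
        using h in_range by (intro d1) (auto simp: dist_real_def)
      moreover have "dist (\<gamma> (\<tau> v - h)) (\<gamma> (\<tau> v)) < e / 2"
        using h in_range by (intro d2) (auto simp: dist_real_def)
      moreover have "dist (\<gamma> (\<tau> u + h)) (\<gamma> (\<tau> v - h)) \<le> l (\<tau> v - h) - l (\<tau> u + h)"
        using h in_range by (intro l_inc) auto
      moreover have "u < l (\<tau> u + h)" using h in_range that by (intro above) auto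
      moreover have "l (\<tau> v - h) \<le> v" using h in_range that by (intro below) auto
      moreover have "dist (\<gamma> (\<tau> u)) (\<gamma> (\<tau> v)) \<le> dist (\<gamma> (\<tau> u + h)) (\<gamma> (\<tau> u)) +
          dist (\<gamma> (\<tau> u + h)) (\<gamma> (\<tau> v - h)) + dist (\<gamma> (\<tau> v - h)) (\<gamma> (\<tau> v))"
        by metric
      ultimately show "dist (g u) (g v) \<le> v - u + e" by (simp add: g_def)
    qed
  qed
  \<comment> \<open>The parameter \<open>t\<close> may lie strictly before
    \<open>\<tau> (l t)\<close>. Then \<open>l\<close> stays at most \<open>l t\<close> up to that
    point, so the chords starting at \<open>\<gamma> t\<close> vanish there, and continuity carries
    the value \<open>\<gamma> t\<close> to \<open>\<tau> (l t)\<close>. This makes the two traces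
    equal.\<close>
  have g_l: "g (l t) = \<gamma> t" if t: "t \<in> {a..b}" for t
  proof -
    have lt: "0 \<le> l t" using l_bounds t by auto
    have "t \<le> \<tau> (l t)"
      unfolding \<tau>_def by (rule cSup_upper[OF _ bdd]) (use t in auto)
    moreover have "\<not> t < \<tau> (l t) \<or> \<gamma> (\<tau> (l t)) = \<gamma> t"
    proof (cases "t < \<tau> (l t)")
      case less: True
      have \<tau>r: "\<tau> (l t) \<in> {a..b}" using \<tau>_range[OF lt] .
      have "dist (\<gamma> (\<tau> (l t))) (\<gamma> t) \<le> 0 + e" if "0 < e" for e
      proof -
        obtain d where d: "d > 0" "\<And>t'. t' \<in> {a..b} \<Longrightarrow> dist t' (\<tau> (l t)) < d \<Longrightarrow> dist (\<gamma> t') (\<gamma> (\<tau> (l t))) < e"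
          using cont \<tau>r \<open>0 < e\<close> unfolding continuous_on_iff by metis
        obtain h where h: "0 < h" "h < d" "h < \<tau> (l t) - t"
          using field_lbound_gt_zero[of d "\<tau> (l t) - t"] d(1) less by auto
        have "dist (\<gamma> (\<tau> (l t) - h)) (\<gamma> (\<tau> (l t))) < e"
          using h \<tau>r t by (intro d) (auto simp: dist_real_def)
        moreover have "l (\<tau> (l t) - h) \<le> l t" using h \<tau>r t lt by (intro below) auto
        moreover have "dist (\<gamma> t) (\<gamma> (\<tau> (l t) - h)) \<le> l (\<tau> (l t) - h) - l t"
          using h \<tau>r t by (intro l_inc) auto
        moreover have "dist (\<gamma> (\<tau> (l t))) (\<gamma> t) \<le>
            dist (\<gamma> (\<tau> (l t) - h)) (\<gamma> (\<tau> (l t))) + dist (\<gamma> t) (\<gamma> (\<tau> (l t) - h))"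
          by metric
        ultimately show ?thesis by linarith
      qed
      then have "dist (\<gamma> (\<tau> (l t))) (\<gamma> t) \<le> 0" by (rule field_le_epsilon)
      then show ?thesis by simp
    qed simp
    ultimately show ?thesis unfolding g_def by force
  qed
  \<comment> \<open>\<open>L\<close> may exceed the arc length of the whole curve; \<open>g\<close>
    then rests at \<open>\<gamma> b\<close> for the remaining parameters.\<close>
  have "\<tau> L = b"
  proof (rule antisym)
    show "\<tau> L \<le> b" using \<tau>_range[of L] l_bounds[of b] assms by force
    show "b \<le> \<tau> L" unfolding \<tau>_def by (rule cSup_upper[OF _ bdd]) (use assms l_bounds in auto)
  qed
  then have gL: "g L = \<gamma> b" by (simp add: g_def)
  have "0 \<le> L" using l_bounds[of a] assms by force
  moreover have "1-lipschitz_on {0..L} g"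
  proof (rule lipschitz_onI)
    fix u v assume "u \<in> {0..L}" "v \<in> {0..L}"
    then show "dist (g u) (g v) \<le> 1 * dist u v"
      using lip[of u v] lip[of v u] by (cases "u \<le> v") (auto simp: dist_real_def dist_commute)
  qed simp
  moreover have "g 0 = \<gamma> a" using g_l[of a] la assms by simp
  moreover have "g ` {0..L} = \<gamma> ` {a..b}"
  proof
    show "g ` {0..L} \<subseteq> \<gamma> ` {a..b}" using \<tau>_range by (auto simp: g_def)
    show "\<gamma> ` {a..b} \<subseteq> g ` {0..L}" 
    proof safe
      fix t assume "t \<in> {a..b}"
      then show "\<gamma> t \<in> g ` {0..L}"
        using g_l[of t] l_bounds[of t] by (intro image_eqI[of _ _ "l t"]) auto
    qed
  qed
  ultimately show ?thesis using that gL by blast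
qed

subsection \<open>Compactness of the curve measures\<close>

text \<open>The points at distance at least \<open>inverse (real (Suc n))\<close> from
  \<open>C\<close> form a compact set, which finitely many null balls cover, and these sets exhaust
  \<open>- C\<close>. Nonemptiness of \<open>C\<close> matters because \<open>infdist\<close> to the
  empty set is 0.\<close>

lemma null_set_complement_of_support:
  fixes \<nu> :: "'a::metric_space measure"
  assumes cpt: "compact (UNIV :: 'a set)" and sets: "sets \<nu> = sets borel"
    and "closed C" "C \<noteq> {}" "measure_support \<nu> \<subseteq> C"
  shows "- C \<in> null_sets \<nu>"
proof -
  define D where "D n = {x. infdist x C \<ge> inverse (real (Suc n))}" for n
  have "D n \<in> null_sets \<nu>" for n
  proof -
    have "closed (D n)" unfolding D_def by (intro closed_Collect_le continuous_intros)
    then have "compact (D n)" using compact_Int_closed[OF cpt] by simp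
    moreover have "\<exists>r>0. emeasure \<nu> (ball x r) = 0" if "x \<in> D n" for x
    proof -
      have "x \<notin> C" using that by (auto simp: D_def)
      then have "x \<notin> measure_support \<nu>" using assms by auto
      then show ?thesis by (auto simp: measure_support_def)
    qed
    then obtain r where r: "\<And>x. x \<in> D n \<Longrightarrow> 0 < r x" "\<And>x. x \<in> D n \<Longrightarrow> emeasure \<nu> (ball x (r x)) = 0"
      by metis
    ultimately obtain X where X: "X \<subseteq> D n" "finite X" "D n \<subseteq> (\<Union>x\<in>X. ball x (r x))"
      by (elim compactE_image[where C = "D n" and f = "\<lambda>x. ball x (r x)"]) auto
    have "(\<Union>x\<in>X. ball x (r x)) \<in> null_sets \<nu>"
      using X r by (intro null_sets_UN' countable_finite null_setsI) (auto simp: sets)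
    then show ?thesis
      by (rule null_sets_subset[OF _ _ X(3)]) (use \<open>closed (D n)\<close> in \<open>simp add: sets\<close>)
  qed
  then have "(\<Union>n. D n) \<in> null_sets \<nu>" by (intro null_sets_UN) auto
  moreover have "- C \<subseteq> (\<Union>n. D n)"
  proof
    fix x assume "x \<in> - C"
    then have "0 < infdist x C"
      using assms(3,4) by (simp add: infdist_pos_not_in_closed)
    then obtain n where "inverse (real (Suc n)) < infdist x C" using reals_Archimedean by blast
    then show "x \<in> (\<Union>n. D n)" by (auto simp: D_def intro!: exI[of _ n])
  qed
  ultimately show ?thesis
    using null_sets_subset[of "\<Union>n. D n" \<nu> "- C"] \<open>closed C\<close> by (simp add: sets)
qed

lemma measure_support_subset:
  assumes "sets \<nu> = sets borel" "closed C" "- C \<in> null_sets \<nu>"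
  shows "measure_support \<nu> \<subseteq> C"
proof
  fix x assume x: "x \<in> measure_support \<nu>"
  show "x \<in> C"
  proof (rule ccontr)
    assume "x \<notin> C"
    then obtain r where r: "r > 0" "ball x r \<subseteq> - C"
      using assms(2) by (metis ComplI open_Compl openE)
    then have "ball x r \<in> null_sets \<nu>"
      by (intro null_sets_subset[OF assms(3)]) (auto simp: assms(1))
    then show False using x r by (force simp: measure_support_def)
  qed
qed

text \<open>The working description of curve measures: all curves share the parameter interval
  \<open>{0..L}\<close>, and the support condition becomes a null set. Curves with a common
  Lipschitz constant pass to pointwise limits, and null sets are easy to check for image
  measures.\<close>

lemma curve_measures_lipschitz_iff:
  fixes \<nu> :: "'a::metric_space measure"
  assumes cpt: "compact (UNIV :: 'a set)" and "0 \<le> L"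
  shows "\<nu> \<in> curve_measures L \<longleftrightarrow> borel_prob \<nu> \<and>
     (\<exists>g. 1-lipschitz_on UNIV g \<and> g 0 = g L \<and> - g ` {0..L} \<in> null_sets \<nu>)"
proof
  assume "\<nu> \<in> curve_measures L"
  then obtain \<gamma> a b where \<nu>: "borel_prob \<nu>" and \<gamma>: "a \<le> b" "continuous_on {a..b} \<gamma>" "\<gamma> a = \<gamma> b"
    and supp: "measure_support \<nu> \<subseteq> \<gamma> ` {a..b}" and len: "curve_length \<gamma> a b \<le> ereal L"
    unfolding curve_measures_def by auto
  obtain g where g: "1-lipschitz_on {0..L} g" "g 0 = \<gamma> a" "g L = \<gamma> b" "g ` {0..L} = \<gamma> ` {a..b}"
    using lipschitz_reparametrization[OF \<gamma>(1,2) len] by metis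
  \<comment> \<open>Clamping the parameter to \<open>{0..L}\<close> is 1-Lipschitz and extends
    \<open>g\<close> to the whole line.\<close>
  define g' where "g' u = g (max 0 (min L u))" for u
  have img: "g' ` {0..L} = g ` {0..L}"
    by (rule image_cong) (auto simp: g'_def)
  have "1-lipschitz_on UNIV g'"
  proof (rule lipschitz_onI)
    fix u v :: real
    have "dist (g' u) (g' v) \<le> 1 * dist (max 0 (min L u)) (max 0 (min L v))"
      unfolding g'_def by (rule lipschitz_onD[OF g(1)]) (use \<open>0 \<le> L\<close> in auto)
    also have "\<dots> \<le> 1 * dist u v" by (auto simp: dist_real_def max_def min_def)
    finally show "dist (g' u) (g' v) \<le> 1 * dist u v" .
  qed simp
  moreover have "- g' ` {0..L} \<in> null_sets \<nu>"
    unfolding img g(4) using \<nu> supp \<gamma>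
    by (intro null_set_complement_of_support cpt)
      (auto simp: borel_prob_def intro!: compact_imp_closed compact_continuous_image)
  moreover have "g' 0 = g' L" using g \<gamma> \<open>0 \<le> L\<close> by (simp add: g'_def)
  ultimately show "borel_prob \<nu> \<and> (\<exists>g. 1-lipschitz_on UNIV g \<and> g 0 = g L \<and> - g ` {0..L} \<in> null_sets \<nu>)"
    using \<nu> by blast
next
  assume "borel_prob \<nu> \<and> (\<exists>g. 1-lipschitz_on UNIV g \<and> g 0 = g L \<and> - g ` {0..L} \<in> null_sets \<nu>)"
  then obtain g where \<nu>: "borel_prob \<nu>" and g: "1-lipschitz_on UNIV g" "g 0 = g L" "- g ` {0..L} \<in> null_sets \<nu>"
    by blast
  have lip: "1-lipschitz_on {0..L} g" using g(1) by (rule lipschitz_on_subset) simp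
  have "closed (g ` {0..L})"
    by (intro compact_imp_closed compact_continuous_image lipschitz_on_continuous_on[OF lip]) simp
  then have "measure_support \<nu> \<subseteq> g ` {0..L}"
    using \<nu> g by (intro measure_support_subset) (auto simp: borel_prob_def)
  moreover have "curve_length g 0 L \<le> ereal L" using lipschitz_curve_length[OF lip \<open>0 \<le> L\<close>] .
  ultimately show "\<nu> \<in> curve_measures L"
    unfolding curve_measures_def using \<nu> g(2) \<open>0 \<le> L\<close> lipschitz_on_continuous_on[OF lip] by blast
qed

text \<open>The smallest parameter of a point is a Borel function because its sublevel sets are images of
  compact subintervals.\<close>
lemma lift_to_parameter:
  fixes \<nu> :: "'a::metric_space measure" and g :: "real \<Rightarrow> 'a"
  assumes \<nu>: "borel_prob \<nu>" and g: "continuous_on UNIV g" and "0 \<le> L" and null: "- g ` {0..L} \<in> null_sets \<nu>"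
  shows "\<exists>s. s \<in> borel_measurable borel \<and> (\<forall>x. s x \<in> {0..L}) \<and> (AE x in \<nu>. g (s x) = x)"
proof -
  \<comment> \<open>The default \<open>L\<close> off the curve keeps \<open>s\<close> inside
    \<open>{0..L}\<close> and adds nothing to the sublevel sets for \<open>c < L\<close>, which are
    therefore exactly the images of \<open>{0..c}\<close>.\<close>
  define s where "s x = (if x \<in> g ` {0..L} then Inf {t\<in>{0..L}. g t = x} else L)" for x
  have cg: "continuous_on A g" for A using g continuous_on_subset by blast
  have s: "s x \<in> {0..L}" "g (s x) = x" "\<And>t. t \<in> {0..L} \<Longrightarrow> g t = x \<Longrightarrow> s x \<le> t" if x: "x \<in> g ` {0..L}" for x
  proof -
    let ?T = "{t\<in>{0..L}. g t = x}"
    have eq: "s x = Inf ?T" using x by (simp add: s_def)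
    have bdd: "bdd_below ?T" by (rule bdd_belowI[of _ 0]) auto
    have "closed ?T"
      using continuous_closed_preimage_constant[OF cg closed_atLeastAtMost, of 0 L x] .
    then have "Inf ?T \<in> ?T" using x bdd by (intro closed_contains_Inf) auto
    then show "s x \<in> {0..L}" "g (s x) = x" unfolding eq by auto
    show "s x \<le> t" if "t \<in> {0..L}" "g t = x" for t
      unfolding eq using bdd that by (intro cInf_lower) auto
  qed
  have range: "s x \<in> {0..L}" for x
    using s(1)[of x] \<open>0 \<le> L\<close> by (cases "x \<in> g ` {0..L}") (auto simp: s_def)
  have "s \<in> borel_measurable borel"
  proof (rule borel_measurable_iff_le[THEN iffD2], rule allI)
    fix c
    show "{w \<in> space borel. s w \<le> c} \<in> sets borel"
    proof (cases "L \<le> c")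
      case True
      then have "{w \<in> space borel. s w \<le> c} = UNIV" using range order_trans by fastforce
      then show ?thesis by simp
    next
      case False
      have "{w \<in> space borel. s w \<le> c} = g ` {0..c}"
      proof (intro equalityI subsetI)
        fix w assume "w \<in> {w \<in> space borel. s w \<le> c}"
        then have w: "s w \<le> c" by simp
        then have "w \<in> g ` {0..L}" using False unfolding s_def by (auto split: if_splits)
        from s[OF this] w show "w \<in> g ` {0..c}" by force
      next
        fix w assume "w \<in> g ` {0..c}"
        then obtain t where t: "t \<in> {0..c}" "w = g t" by blast
        then have "t \<in> {0..L}" using False by auto
        then have "s w \<le> t" using t s(3)[of w t] by blast
        then show "w \<in> {w \<in> space borel. s w \<le> c}" using t by auto
      qed
      moreover have "closed (g ` {0..c})"
        by (intro compact_imp_closed compact_continuous_image cg) simp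
      ultimately show ?thesis by simp
    qed
  qed
  moreover have "AE x in \<nu>. g (s x) = x"
    by (rule AE_I'[OF null]) (use s in auto)
  ultimately show ?thesis using range by blast
qed

text \<open>An Arzela-Ascoli argument. The product over the countable type \<open>rat\<close> is a
  compact metric space, so a subsequence converges at all rationals; the common Lipschitz constant
  spreads the Cauchy property to every real parameter, and completeness gives the limit.\<close>

lemma lipschitz_convergent_subsequence:
  fixes g :: "nat \<Rightarrow> real \<Rightarrow> 'a::metric_space"
  assumes cpt: "compact (UNIV :: 'a set)" and lip: "\<And>n. 1-lipschitz_on UNIV (g n)"
  shows "\<exists>r h. strict_mono (r :: nat \<Rightarrow> nat) \<and> 1-lipschitz_on UNIV h \<and> (\<forall>u. (\<lambda>n. g (r n) u) \<longlonglongrightarrow> h u)"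
proof -
  define G :: "nat \<Rightarrow> rat \<Rightarrow> 'a" where "G n q = g n (of_rat q)" for n q
  have "compactin euclidean (UNIV :: (rat \<Rightarrow> 'a) set)"
  proof -
    have "compactin (product_topology (\<lambda>_. euclidean) (UNIV :: rat set)) (PiE UNIV (\<lambda>_. UNIV :: 'a set))"
      by (subst compactin_PiE) (simp add: cpt)
    then show ?thesis by (simp add: euclidean_product_topology)
  qed
  then have "compact (UNIV :: (rat \<Rightarrow> 'a) set)" by simp
  then have "seq_compact (UNIV :: (rat \<Rightarrow> 'a) set)" by (simp add: compact_eq_seq_compact_metric)
  then obtain H r where r: "strict_mono r" and H: "(G \<circ> r) \<longlonglongrightarrow> H"
    unfolding seq_compact_def by (metis UNIV_I)
  have Hq: "(\<lambda>n. g (r n) (of_rat q)) \<longlonglongrightarrow> H q" for q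
  proof -
    have "continuous_on UNIV (\<lambda>f :: rat \<Rightarrow> 'a. f q)" by (rule continuous_on_product_coordinates)
    from continuous_on_tendsto_compose[OF this H] show ?thesis by (simp add: G_def)
  qed
  have "Cauchy (\<lambda>n. g (r n) u)" for u
  proof (rule metric_CauchyI)
    fix e :: real assume "0 < e"
    obtain q :: rat where q: "u - e / 4 < of_rat q" "of_rat q < u"
      using of_rat_dense[of "u - e / 4" u] \<open>0 < e\<close> by auto
    have close: "dist (g n u) (g n (of_rat q)) < e / 4" for n
      using lipschitz_onD[OF lip[of n], of u "of_rat q"] q by (simp add: dist_real_def)
    have "Cauchy (\<lambda>n. g (r n) (of_rat q))" using Hq LIMSEQ_imp_Cauchy by blast
    then obtain N where N: "\<And>m n. m \<ge> N \<Longrightarrow> n \<ge> N \<Longrightarrow> dist (g (r m) (of_rat q)) (g (r n) (of_rat q)) < e / 4"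
      using metric_CauchyD[of _ "e / 4"] \<open>0 < e\<close> by (metis divide_pos_pos zero_less_numeral)
    have "dist (g (r m) u) (g (r n) u) < e" if "m \<ge> N" "n \<ge> N" for m n
    proof -
      have "dist (g (r m) u) (g (r n) u) \<le> dist (g (r m) u) (g (r m) (of_rat q)) +
          dist (g (r m) (of_rat q)) (g (r n) (of_rat q)) + dist (g (r n) u) (g (r n) (of_rat q))"
        by metric
      then show ?thesis using close[of "r m"] close[of "r n"] N[OF that] \<open>0 < e\<close> by simp
    qed
    then show "\<exists>M. \<forall>m\<ge>M. \<forall>n\<ge>M. dist (g (r m) u) (g (r n) u) < e" by blast
  qed
  then have "\<exists>l. (\<lambda>n. g (r n) u) \<longlonglongrightarrow> l" for u
    using compact_imp_complete[OF cpt] by (meson UNIV_I completeE)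
  then obtain h where h: "\<And>u. (\<lambda>n. g (r n) u) \<longlonglongrightarrow> h u" by metis
  have "1-lipschitz_on UNIV h"
  proof (rule lipschitz_onI)
    fix u v :: real
    show "dist (h u) (h v) \<le> 1 * dist u v"
      by (rule LIMSEQ_le_const2[OF tendsto_dist[OF h h]]) (use lipschitz_onD[OF lip UNIV_I UNIV_I] in blast)
  qed simp
  then show ?thesis using r h by blast
qed

text \<open>Compactness of the curve measures, stated through random variables that converge pointwise: Helly's theorem
  applies to the parameters on the real line, and Skorohod's theorem makes the weak limit pointwise.\<close>
lemma curve_measures_convergent_subsequence:
  fixes \<nu> :: "nat \<Rightarrow> 'a::metric_space measure"
  assumes cpt: "compact (UNIV :: 'a set)" and L: "0 \<le> L" and \<nu>: "\<And>n. \<nu> n \<in> curve_measures L"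
  obtains r :: "nat \<Rightarrow> nat" and \<Omega> :: "real measure" and X :: "nat \<Rightarrow> real \<Rightarrow> 'a" and X' where
    "strict_mono r" "prob_space \<Omega>" "\<And>n. X n \<in> measurable \<Omega> borel" "X' \<in> measurable \<Omega> borel"
    "\<And>n. distr \<Omega> borel (X n) = \<nu> (r n)" "distr \<Omega> borel X' \<in> curve_measures L"
    "\<And>\<omega>. \<omega> \<in> space \<Omega> \<Longrightarrow> (\<lambda>n. X n \<omega>) \<longlonglongrightarrow> X' \<omega>"
proof -
  have prob: "borel_prob (\<nu> n)" for n using \<nu> by (auto simp: curve_measures_def)
  obtain g where g: "\<And>n. 1-lipschitz_on UNIV (g n)" "\<And>n. g n 0 = g n L"
      "\<And>n. - g n ` {0..L} \<in> null_sets (\<nu> n)"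
    using \<nu> unfolding curve_measures_lipschitz_iff[OF cpt L] by metis
  obtain s where "\<forall>n. s n \<in> borel_measurable borel \<and> (\<forall>x. s n x \<in> {0..L}) \<and> (AE x in \<nu> n. g n (s n x) = x)"
    using choice[OF allI[OF lift_to_parameter[OF prob lipschitz_on_continuous_on[OF g(1)] L g(3)]]] by (rule exE)
  then have s: "\<And>n. s n \<in> borel_measurable borel" "\<And>n x. s n x \<in> {0..L}"
      "\<And>n. AE x in \<nu> n. g n (s n x) = x"
    by simp_all
  obtain r1 h where r1: "strict_mono r1" and h: "1-lipschitz_on UNIV h" "\<And>u. (\<lambda>n. g (r1 n) u) \<longlonglongrightarrow> h u"
    using lipschitz_convergent_subsequence[where g = g, OF cpt g(1)] by blast
  have [measurable]: "s n \<in> borel_measurable (\<nu> m)" for n m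
    using s(1) prob[of m] by (simp add: borel_prob_def cong: measurable_cong_sets)
  define \<rho> where "\<rho> n = distr (\<nu> n) borel (s n)" for n
  have dist: "real_distribution (\<rho> n)" for n
    using prob[of n] unfolding \<rho>_def borel_prob_def by (intro prob_space.real_distribution_distr) auto
  have "tight \<rho>"
    unfolding tight_def
  proof (intro conjI allI impI dist)
    fix e :: real assume "0 < e"
    \<comment> \<open>The lower end -1 puts the parameter 0 inside the left-open interval that
      tightness asks for, and keeps the interval nondegenerate when \<open>L = 0\<close>.\<close>
    have "measure (\<rho> n) {-1<..L} = 1" for n
    proof -
      interpret prob_space "\<nu> n" using prob by (simp add: borel_prob_def)
      have "s n -` {-1<..L} \<inter> space (\<nu> n) = space (\<nu> n)"
        using s(2)[of n] by (auto intro!: less_le_trans[of "-1" 0 "s n _"])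
      then show ?thesis unfolding \<rho>_def by (simp add: measure_distr prob_space)
    qed
    then show "\<exists>a b. a < b \<and> (\<forall>n. 1 - e < measure (\<rho> n) {a<..b})"
      using \<open>0 < e\<close> L by (intro exI[of _ "-1"] exI[of _ L]) simp
  qed
  from tight_imp_convergent_subsubsequence[OF this r1] obtain r2 M where r2: "strict_mono r2"
    and M: "real_distribution M" "weak_conv_m (\<rho> \<circ> r1 \<circ> r2) M" by blast
  have "real_distribution ((\<rho> \<circ> r1 \<circ> r2) n)" for n using dist by simp
  from Skorohod[OF this M] obtain \<Omega> :: "real measure" and Y Y' where \<Omega>: "prob_space \<Omega>"
    and Y: "\<And>n. Y n \<in> measurable \<Omega> borel" "\<And>n. distr \<Omega> borel (Y n) = (\<rho> \<circ> r1 \<circ> r2) n"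
    and Y': "Y' \<in> measurable \<Omega> lborel" "\<And>\<omega>. \<omega> \<in> space \<Omega> \<Longrightarrow> (\<lambda>n. Y n \<omega>) \<longlonglongrightarrow> Y' \<omega>"
    by blast
  interpret prob_space \<Omega> by fact
  define r where "r = r1 \<circ> r2"
  have [measurable]: "Y n \<in> measurable \<Omega> borel" "Y' \<in> measurable \<Omega> borel" for n
    using Y(1) Y'(1) by simp_all
  have [measurable]: "g n \<in> measurable borel borel" "h \<in> measurable borel borel" for n
    using g(1) h(1) by (auto intro!: borel_measurable_continuous_onI lipschitz_on_continuous_on)
  define X where "X n \<omega> = g (r n) (Y n \<omega>)" for n \<omega>
  define X' where "X' \<omega> = h (Y' \<omega>)" for \<omega>
  \<comment> \<open>Lifting to the parameter by \<open>s\<close> and returning along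
    \<open>g\<close> is the identity almost everywhere, so the original law is recovered.\<close>
  have law: "distr \<Omega> borel (X n) = \<nu> (r n)" for n
  proof -
    have "distr \<Omega> borel (X n) = distr (distr \<Omega> borel (Y n)) borel (g (r n))"
      unfolding X_def[abs_def] by (subst distr_distr) (auto simp: comp_def)
    also have "\<dots> = distr (\<nu> (r n)) borel (\<lambda>x. g (r n) (s (r n) x))"
      unfolding Y(2) \<rho>_def comp_def r_def by (subst distr_distr) (auto simp: comp_def)
    also have "\<dots> = distr (\<nu> (r n)) borel (\<lambda>x. x)"
    proof (rule distr_cong_AE)
      show "AE x in \<nu> (r n). g (r n) (s (r n) x) = x" using s(3) .
      show "(\<lambda>x. x) \<in> \<nu> (r n) \<rightarrow>\<^sub>M borel"
        using prob[of "r n"] by (simp add: borel_prob_def cong: measurable_cong_sets)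
    qed auto
    also have "\<dots> = \<nu> (r n)"
      using prob[of "r n"] by (simp add: borel_prob_def distr_id2)
    finally show ?thesis .
  qed
  \<comment> \<open>The common Lipschitz constant splits the error into the movement of the
    parameter and the movement of the curve at the fixed parameter
    \<open>Y' \<omega>\<close>.\<close>
  have lim: "(\<lambda>n. X n \<omega>) \<longlonglongrightarrow> X' \<omega>" if "\<omega> \<in> space \<Omega>" for \<omega>
  proof (rule metric_tendsto_imp_tendsto)
    have "(\<lambda>n. g (r n) (Y' \<omega>)) \<longlonglongrightarrow> h (Y' \<omega>)"
      using LIMSEQ_subseq_LIMSEQ[OF h(2) r2] by (simp add: r_def comp_def)
    then have "(\<lambda>n. dist (Y n \<omega>) (Y' \<omega>) + dist (g (r n) (Y' \<omega>)) (h (Y' \<omega>))) \<longlonglongrightarrow> 0 + 0"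
      using Y'(2)[OF that] by (intro tendsto_add) (simp_all add: tendsto_dist_iff[symmetric])
    then show "(\<lambda>n. dist (Y n \<omega>) (Y' \<omega>) + dist (g (r n) (Y' \<omega>)) (h (Y' \<omega>))) \<longlonglongrightarrow> 0" by simp
    have "dist (X n \<omega>) (X' \<omega>) \<le> dist (Y n \<omega>) (Y' \<omega>) + dist (g (r n) (Y' \<omega>)) (h (Y' \<omega>))" for n
    proof -
      have "dist (g (r n) (Y n \<omega>)) (g (r n) (Y' \<omega>)) \<le> dist (Y n \<omega>) (Y' \<omega>)"
        using lipschitz_onD[OF g(1)[of "r n"], of "Y n \<omega>" "Y' \<omega>"] by simp
      then show ?thesis
        using dist_triangle[of "X n \<omega>" "X' \<omega>" "g (r n) (Y' \<omega>)"] by (simp add: X_def X'_def)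
    qed
    then show "\<forall>\<^sub>F n in sequentially. dist (X n \<omega>) (X' \<omega>) \<le>
        dist (dist (Y n \<omega>) (Y' \<omega>) + dist (g (r n) (Y' \<omega>)) (h (Y' \<omega>))) 0"
      by (simp add: dist_real_def)
  qed
  have [measurable]: "X n \<in> measurable \<Omega> borel" "X' \<in> measurable \<Omega> borel" for n
    unfolding X_def X'_def by measurable
  \<comment> \<open>The parameters stay in a closed interval, so their limit does too, and the limit
    law lives on the limit curve.\<close>
  have "AE \<omega> in \<Omega>. Y n \<omega> \<in> {0..L}" for n
  proof -
    have "AE u in \<rho> (r n). u \<in> {0..L}"
      unfolding \<rho>_def by (subst AE_distr_iff) (use s(2) in auto)
    moreover have "distr \<Omega> borel (Y n) = \<rho> (r n)" using Y(2)[of n] by (simp add: r_def)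
    ultimately have "AE u in distr \<Omega> borel (Y n). u \<in> {0..L}" by (simp only:)
    then show ?thesis by (subst (asm) AE_distr_iff) auto
  qed
  then have "AE \<omega> in \<Omega>. \<forall>n. Y n \<omega> \<in> {0..L}" by (simp add: AE_all_countable)
  then have "AE \<omega> in \<Omega>. Y' \<omega> \<in> {0..L}"
  proof (rule AE_mp, intro AE_I2 impI)
    fix \<omega> assume "\<omega> \<in> space \<Omega>" "\<forall>n. Y n \<omega> \<in> {0..L}"
    then show "Y' \<omega> \<in> {0..L}"
      using closed_sequentially[OF closed_atLeastAtMost, of "\<lambda>n. Y n \<omega>" 0 L "Y' \<omega>"] Y'(2) by blast
  qed
  then have AE: "AE \<omega> in \<Omega>. X' \<omega> \<in> h ` {0..L}"
    by (rule AE_mp) (auto simp: X'_def)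
  have closed: "closed (h ` {0..L})"
    by (intro compact_imp_closed compact_continuous_image continuous_on_subset[OF lipschitz_on_continuous_on[OF h(1)]]) auto
  then have "{x \<in> space borel. x \<in> h ` {0..L}} \<in> sets borel" by simp
  then have "AE x in distr \<Omega> borel X'. x \<in> h ` {0..L}"
    using AE by (subst AE_distr_iff) auto
  then have "- h ` {0..L} \<in> null_sets (distr \<Omega> borel X')"
    by (subst AE_iff_null_sets) (use closed in auto)
  moreover have "h 0 = h L"
  proof -
    have "(\<lambda>n. g (r1 n) 0) \<longlonglongrightarrow> h L" using h(2)[of L] g(2) by simp
    then show ?thesis using h(2)[of 0] LIMSEQ_unique by blast
  qed
  ultimately have "distr \<Omega> borel X' \<in> curve_measures L"
    unfolding curve_measures_lipschitz_iff[OF cpt L] using h(1)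
    by (auto simp: borel_prob_def intro!: prob_space_distr)
  moreover have "strict_mono r" unfolding r_def using r1 r2 by (rule strict_mono_o)
  ultimately show ?thesis using that \<Omega> law lim \<open>\<And>n. X n \<in> _\<close> \<open>X' \<in> _\<close> by blast
qed

subsection \<open>Existence of minimizers\<close>

locale compact_kernel =
  fixes K :: "'a::metric_space \<Rightarrow> 'a \<Rightarrow> real"
  assumes cpt: "compact (UNIV :: 'a set)"
    and cont: "continuous_on UNIV (\<lambda>(x, y). K x y)"
    and sym: "K x y = K y x"
begin

section \<open>Potentials: continuity, bounds and integrability\<close>

definition potential :: "'a measure \<Rightarrow> 'a \<Rightarrow> real" where
  "potential \<nu> x = (\<integral>y. K x y \<partial>\<nu>)"

lemma kernel_tendsto:
  assumes "(f \<longlongrightarrow> x) F" "(g \<longlongrightarrow> y) F"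
  shows "((\<lambda>n. K (f n) (g n)) \<longlongrightarrow> K x y) F"
  using continuous_on_tendsto_compose[OF cont tendsto_Pair[OF assms]] by simp

lemma kernel_continuous: "continuous_on UNIV (K x)"
  unfolding continuous_on_def by (auto intro!: kernel_tendsto)

lemma kernel_measurable [measurable]: "K x \<in> borel_measurable borel"
  by (rule borel_measurable_continuous_onI[OF kernel_continuous])

lemma kernel_bounded: obtains M where "0 < M" "\<And>x y. \<bar>K x y\<bar> \<le> M"
proof -
  have "compact ((\<lambda>(x, y). K x y) ` UNIV)"
    using compact_Times[OF cpt cpt] by (intro compact_continuous_image[OF cont]) simp
  then obtain M where "0 < M" "\<forall>z\<in>(\<lambda>(x, y). K x y) ` UNIV. norm z \<le> M"
    using compact_imp_bounded bounded_pos by blast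
  then show ?thesis using that[of M] by (auto simp: image_iff)
qed

lemma potential_distr:
  "X \<in> measurable \<Omega> borel \<Longrightarrow> potential (distr \<Omega> borel X) x = (\<integral>\<omega>. K x (X \<omega>) \<partial>\<Omega>)"
  unfolding potential_def by (rule integral_distr) auto

lemma discrepancy_potential:
  "discrepancy K \<mu> \<nu> = sqrt ((\<integral>x. potential \<mu> x \<partial>\<mu>) - 2 * (\<integral>x. potential \<nu> x \<partial>\<mu>) + (\<integral>x. potential \<nu> x \<partial>\<nu>))"
  by (simp add: discrepancy_def potential_def)

context
  fixes \<nu> :: "'a measure"
  assumes \<nu>: "borel_prob \<nu>"
begin

interpretation prob_space \<nu> using \<nu> by (simp add: borel_prob_def)

lemma measurable_borel_prob: "f \<in> borel_measurable borel \<Longrightarrow> f \<in> borel_measurable \<nu>"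
  using \<nu> by (simp add: borel_prob_def cong: measurable_cong_sets)

lemma integrable_bounded:
  fixes f :: "'a \<Rightarrow> real"
  shows "f \<in> borel_measurable borel \<Longrightarrow> (\<And>x. \<bar>f x\<bar> \<le> M) \<Longrightarrow> integrable \<nu> f"
  by (intro integrable_const_bound[of f M] measurable_borel_prob) auto

lemma abs_integral_le:
  fixes f :: "'a \<Rightarrow> real"
  assumes "f \<in> borel_measurable borel" "\<And>x. \<bar>f x\<bar> \<le> M"
  shows "\<bar>\<integral>x. f x \<partial>\<nu>\<bar> \<le> M"
proof -
  have i: "integrable \<nu> f" using assms by (rule integrable_bounded)
  have "f x \<le> M" "- M \<le> f x" for x using assms(2)[of x] by auto
  then show ?thesis
    using integral_le_const[OF i, of M] integral_ge_const[OF i, of "- M"] by (simp add: abs_le_iff)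
qed

lemma kernel_integrable: "integrable \<nu> (K x)"
  using kernel_bounded integrable_bounded[OF kernel_measurable] by metis

lemma potential_continuous: "continuous_on UNIV (potential \<nu>)"
  unfolding continuous_on_sequentially
proof (intro allI ballI impI)
  fix x and f :: "nat \<Rightarrow> 'a"
  assume "x \<in> UNIV" and "(\<forall>n. f n \<in> UNIV) \<and> f \<longlonglongrightarrow> x"
  then have f: "f \<longlonglongrightarrow> x" by simp
  obtain M where M: "\<And>x y. \<bar>K x y\<bar> \<le> M" using kernel_bounded by metis
  have "(\<lambda>n. \<integral>y. K (f n) y \<partial>\<nu>) \<longlonglongrightarrow> (\<integral>y. K x y \<partial>\<nu>)"
    by (rule integral_dominated_convergence[where w = "\<lambda>_. M"])
      (auto intro!: measurable_borel_prob M kernel_tendsto f)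
  then show "(potential \<nu> \<circ> f) \<longlonglongrightarrow> potential \<nu> x" by (simp add: potential_def comp_def)
qed

lemma potential_measurable [measurable]: "potential \<nu> \<in> borel_measurable borel"
  by (rule borel_measurable_continuous_onI[OF potential_continuous])

lemma potential_bounded: "(\<And>x y. \<bar>K x y\<bar> \<le> M) \<Longrightarrow> \<bar>potential \<nu> x\<bar> \<le> M"
  unfolding potential_def by (rule abs_integral_le) auto

end

lemma potential_integrable: "borel_prob \<mu> \<Longrightarrow> borel_prob \<nu> \<Longrightarrow> integrable \<mu> (potential \<nu>)"
  using kernel_bounded integrable_bounded[OF _ potential_measurable potential_bounded] by metis

lemma iterated_bounded:
  assumes "borel_prob \<mu>" "borel_prob \<nu>" "\<And>x y. \<bar>K x y\<bar> \<le> M"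
  shows "\<bar>\<integral>x. potential \<nu> x \<partial>\<mu>\<bar> \<le> M"
  by (rule abs_integral_le[OF assms(1) potential_measurable[OF assms(2)] potential_bounded[OF assms(2,3)]])

text \<open>Makes the infimum over the curve measures meaningful. The three double integrals, with
  weights 1, 2 and 1, are each bounded by \<open>M\<close>, and \<open>sqrt\<close> is monotone and
  odd on the whole real line.\<close>

lemma discrepancy_lower_bound:
  assumes "borel_prob \<mu>" "borel_prob \<nu>" "\<And>x y. \<bar>K x y\<bar> \<le> M"
  shows "- sqrt (4 * M) \<le> discrepancy K \<mu> \<nu>"
proof -
  have "\<bar>(\<integral>x. potential \<mu> x \<partial>\<mu>) - 2 * (\<integral>x. potential \<nu> x \<partial>\<mu>) + (\<integral>x. potential \<nu> x \<partial>\<nu>)\<bar> \<le> 4 * M"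
    using iterated_bounded[OF assms(1,1,3)] iterated_bounded[OF assms(1,2,3)] iterated_bounded[OF assms(2,2,3)]
    by linarith
  then show ?thesis
    unfolding discrepancy_potential by (simp flip: real_sqrt_minus)
qed

text \<open>Representing the measures as laws of pointwise convergent random variables reduces weak
  continuity to dominated convergence, with the constant bound \<open>M\<close> of the kernel as
  dominating function.\<close>

lemma discrepancy_tendsto:
  fixes \<Omega> :: "'b measure"
  assumes \<mu>: "borel_prob \<mu>" and "prob_space \<Omega>"
    and X: "\<And>n. X n \<in> measurable \<Omega> borel" "X' \<in> measurable \<Omega> borel"
    and lim: "\<And>\<omega>. \<omega> \<in> space \<Omega> \<Longrightarrow> (\<lambda>n. X n \<omega>) \<longlonglongrightarrow> X' \<omega>"
  shows "(\<lambda>n. discrepancy K \<mu> (distr \<Omega> borel (X n))) \<longlonglongrightarrow> discrepancy K \<mu> (distr \<Omega> borel X')"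
proof -
  interpret prob_space \<Omega> by fact
  note [measurable] = X
  obtain M where M: "\<And>x y. \<bar>K x y\<bar> \<le> M" using kernel_bounded by metis
  have prob: "borel_prob (distr \<Omega> borel (X n))" "borel_prob (distr \<Omega> borel X')" for n
    using X by (auto simp: borel_prob_def intro: prob_space_distr)
  \<comment> \<open>The argument \<open>f n\<close> moves as well, because in the double integral of
    the curve measure against itself both slots of \<open>K\<close> change with
    \<open>n\<close>.\<close>
  have pot: "(\<lambda>n. potential (distr \<Omega> borel (X n)) (f n)) \<longlonglongrightarrow> potential (distr \<Omega> borel X') x"
    if f: "f \<longlonglongrightarrow> x" for f x
  proof -
    have "(\<lambda>n. \<integral>\<omega>. K (f n) (X n \<omega>) \<partial>\<Omega>) \<longlonglongrightarrow> (\<integral>\<omega>. K x (X' \<omega>) \<partial>\<Omega>)"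
      by (rule integral_dominated_convergence[where w = "\<lambda>_. M"])
        (auto intro!: M kernel_tendsto f lim)
    then show ?thesis by (simp add: potential_distr X)
  qed
  interpret \<mu>: prob_space \<mu> using \<mu> by (simp add: borel_prob_def)
  have "(\<lambda>n. \<integral>x. potential (distr \<Omega> borel (X n)) x \<partial>\<mu>) \<longlonglongrightarrow> (\<integral>x. potential (distr \<Omega> borel X') x \<partial>\<mu>)"
    by (rule integral_dominated_convergence[where w = "\<lambda>_. M"])
      (auto intro!: pot measurable_borel_prob[OF \<mu>] potential_measurable potential_bounded prob M)
  moreover have "(\<lambda>n. \<integral>x. potential (distr \<Omega> borel (X n)) x \<partial>distr \<Omega> borel (X n))
      \<longlonglongrightarrow> (\<integral>x. potential (distr \<Omega> borel X') x \<partial>distr \<Omega> borel X')"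
  proof -
    have [measurable]: "potential (distr \<Omega> borel (X n)) \<in> borel_measurable borel"
      "potential (distr \<Omega> borel X') \<in> borel_measurable borel" for n
      by (rule potential_measurable[OF prob(1)], rule potential_measurable[OF prob(2)])
    have "(\<lambda>n. \<integral>\<omega>. potential (distr \<Omega> borel (X n)) (X n \<omega>) \<partial>\<Omega>)
        \<longlonglongrightarrow> (\<integral>\<omega>. potential (distr \<Omega> borel X') (X' \<omega>) \<partial>\<Omega>)"
      by (rule integral_dominated_convergence[where w = "\<lambda>_. M"])
        (auto intro!: pot lim potential_bounded prob M)
    then show ?thesis by (simp add: integral_distr)
  qed
  ultimately show ?thesis
    unfolding discrepancy_potential by (intro tendsto_intros)
qed

lemma discrepancy_attains_min:
  assumes \<mu>: "borel_prob \<mu>" and L: "0 \<le> L"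
  shows "\<exists>\<nu>\<in>curve_measures L. \<forall>\<nu>'\<in>curve_measures L. discrepancy K \<mu> \<nu> \<le> discrepancy K \<mu> \<nu>'"
proof -
  let ?D = "discrepancy K \<mu> ` curve_measures L"
  obtain M where M: "\<And>x y. \<bar>K x y\<bar> \<le> M" using kernel_bounded by metis
  have bdd: "bdd_below ?D"
  proof (rule bdd_belowI2)
    fix \<nu> :: "'a measure" assume "\<nu> \<in> curve_measures L"
    then have "borel_prob \<nu>" by (simp add: curve_measures_def)
    from discrepancy_lower_bound[OF \<mu> this M] show "- sqrt (4 * M) \<le> discrepancy K \<mu> \<nu>" .
  qed
  have ne: "?D \<noteq> {}"
  proof -
    fix x :: 'a
    \<comment> \<open>A point mass sits on a constant curve, so the infimum is over a nonempty
      set.\<close>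
    have "return borel x \<in> curve_measures L"
      unfolding curve_measures_lipschitz_iff[OF cpt L] borel_prob_def using L
      by (intro conjI exI[of _ "\<lambda>_. x"])
        (auto simp: prob_space_return lipschitz_on_def null_sets_def emeasure_return image_constant_conv)
    then show ?thesis by blast
  qed
  have "\<exists>\<nu>\<in>curve_measures L. discrepancy K \<mu> \<nu> < Inf ?D + inverse (real (Suc n))" for n
    using cInf_lessD[OF ne, of "Inf ?D + inverse (real (Suc n))"] by (auto simp del: of_nat_Suc)
  then obtain \<nu> where \<nu>: "\<And>n. \<nu> n \<in> curve_measures L"
      "\<And>n. discrepancy K \<mu> (\<nu> n) < Inf ?D + inverse (real (Suc n))" by metis
  obtain r :: "nat \<Rightarrow> nat" and \<Omega> :: "real measure" and X :: "nat \<Rightarrow> real \<Rightarrow> 'a" and X' where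
    r: "strict_mono r" and \<Omega>: "prob_space \<Omega>"
    and X: "\<And>n. X n \<in> measurable \<Omega> borel" "X' \<in> measurable \<Omega> borel"
      "\<And>n. distr \<Omega> borel (X n) = \<nu> (r n)"
    and X': "distr \<Omega> borel X' \<in> curve_measures L"
      "\<And>\<omega>. \<omega> \<in> space \<Omega> \<Longrightarrow> (\<lambda>n. X n \<omega>) \<longlonglongrightarrow> X' \<omega>" proof (rule curve_measures_convergent_subsequence[where \<nu> = \<nu>, OF cpt L \<nu>(1)], goal_cases)
    case 1
    show ?case by (rule 1(1)) (fact 1)+
  qed
  have "discrepancy K \<mu> (distr \<Omega> borel X') \<le> Inf ?D + 0"
  proof (rule LIMSEQ_le)
    show "(\<lambda>n. discrepancy K \<mu> (\<nu> (r n))) \<longlonglongrightarrow> discrepancy K \<mu> (distr \<Omega> borel X')"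
      using discrepancy_tendsto[OF \<mu> \<Omega> X(1,2) X'(2)] by (simp add: X(3))
    show "(\<lambda>n. Inf ?D + inverse (real (Suc (r n)))) \<longlonglongrightarrow> Inf ?D + 0"
      using LIMSEQ_subseq_LIMSEQ[OF LIMSEQ_inverse_real_of_nat r]
      by (intro tendsto_add tendsto_const) (simp add: comp_def)
  qed (use \<nu>(2) less_imp_le in blast)
  moreover have "Inf ?D \<le> discrepancy K \<mu> \<nu>'" if "\<nu>' \<in> curve_measures L" for \<nu>'
    using bdd that by (intro cInf_lower) auto
  ultimately show ?thesis using X'(1) by force
qed

end

subsection \<open>Approximation by point measures\<close>

text \<open>Uniform over positions rather than points, so repeated entries count with multiplicity.
  The list has to be nonempty for \<open>pmf_of_set\<close> to be the uniform distribution.\<close>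

definition empirical_measure :: "'a::metric_space list \<Rightarrow> 'a measure" where
  "empirical_measure xs = distr (measure_pmf (pmf_of_set {..<length xs})) borel ((!) xs)"

lemma borel_prob_empirical_measure: "borel_prob (empirical_measure xs)"
  by (auto simp: borel_prob_def empirical_measure_def intro!: prob_space.prob_space_distr measure_pmf.prob_space_axioms)

lemma integral_empirical_measure:
  fixes f :: "'a::metric_space \<Rightarrow> real"
  assumes "xs \<noteq> []" "f \<in> borel_measurable borel"
  shows "(\<integral>x. f x \<partial>empirical_measure xs) = sum_list (map f xs) / length xs"
proof -
  have "(\<integral>x. f x \<partial>empirical_measure xs) = (\<Sum>i<length xs. f (xs ! i)) / length xs"
    unfolding empirical_measure_def using assms
    by (subst integral_distr) (auto simp: integral_pmf_of_set lessThan_empty_iff)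
  also have "(\<Sum>i<length xs. f (xs ! i)) = sum_list (map f xs)"
    by (simp add: sum_list_sum_nth atLeast0LessThan)
  finally show ?thesis .
qed

lemma null_sets_empirical_measure:
  fixes xs :: "'a::metric_space list"
  assumes "xs \<noteq> []" "closed C" "set xs \<subseteq> C"
  shows "- C \<in> null_sets (empirical_measure xs)"
proof -
  have "{..<length xs} \<inter> ((!) xs -` (- C)) = {}"
    using assms(3) by (auto simp: subset_iff)
  then have "emeasure (measure_pmf (pmf_of_set {..<length xs})) ((!) xs -` (- C)) = 0"
    using assms(1) by (subst emeasure_pmf_of_set) auto
  then show ?thesis
    using assms(2) by (simp add: null_sets_def empirical_measure_def emeasure_distr)
qed

context compact_kernel
begin

text \<open>Multiplied by the square of the number of points, the squared discrepancy of the empirical measure of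
  the points grows by at most \<open>2 * M\<close> on average when a \<open>\<mu>\<close>-random point is added, because
  the mixed terms cancel. Hence a good point can always be added.\<close>
lemma greedy_points:
  assumes \<mu>: "borel_prob \<mu>" and M: "\<And>x y. \<bar>K x y\<bar> \<le> M"
  shows "\<exists>xs. length xs = n \<and>
    (\<Sum>x\<leftarrow>xs. \<Sum>y\<leftarrow>xs. K x y) - 2 * real n * (\<Sum>x\<leftarrow>xs. potential \<mu> x) +
      (real n)\<^sup>2 * (\<integral>x. potential \<mu> x \<partial>\<mu>) \<le> 2 * M * real n"
proof (induction n)
  case 0
  show ?case by simp
next
  case (Suc n)
  interpret prob_space \<mu> using \<mu> by (simp add: borel_prob_def)
  define I where "I = (\<integral>x. potential \<mu> x \<partial>\<mu>)"
  define F where "F xs = (\<Sum>x\<leftarrow>xs. \<Sum>y\<leftarrow>xs. K x y) - 2 * real (length xs) * (\<Sum>x\<leftarrow>xs. potential \<mu> x) +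
      (real (length xs))\<^sup>2 * I" for xs
  obtain xs where xs: "length xs = n" "F xs \<le> 2 * M * real n"
    using Suc.IH by (auto simp: F_def I_def)
  \<comment> \<open>The increment of \<open>F\<close> caused by adding the point \<open>z\<close> to
    \<open>xs\<close>.\<close>
  define G where "G z = K z z + 2 * (\<Sum>x\<leftarrow>xs. K x z) - 2 * real (Suc n) * potential \<mu> z
      - 2 * (\<Sum>x\<leftarrow>xs. potential \<mu> x) + (2 * real n + 1) * I" for z
  have F_Cons: "F (z # xs) = F xs + G z" for z
  proof -
    have "(\<Sum>x\<leftarrow>xs. K z x) = (\<Sum>x\<leftarrow>xs. K x z)" using sym by (intro arg_cong[of _ _ sum_list] map_cong) auto
    then have "(\<Sum>x\<leftarrow>z # xs. \<Sum>y\<leftarrow>z # xs. K x y) =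
        K z z + 2 * (\<Sum>x\<leftarrow>xs. K x z) + (\<Sum>x\<leftarrow>xs. \<Sum>y\<leftarrow>xs. K x y)"
      by (simp add: sum_list_addf)
    then show ?thesis
      unfolding F_def G_def using xs(1) by (simp add: algebra_simps power2_eq_square)
  qed
  have diag: "(\<lambda>z. K z z) \<in> borel_measurable borel"
    by (rule borel_measurable_continuous_onI)
      (auto simp: continuous_on_def intro!: kernel_tendsto)
  have int_diag: "integrable \<mu> (\<lambda>z. K z z)"
    by (rule integrable_bounded[OF \<mu> diag M])
  have int_sum: "integrable \<mu> (\<lambda>z. \<Sum>x\<leftarrow>ys. K x z)"
    and sum: "(\<integral>z. (\<Sum>x\<leftarrow>ys. K x z) \<partial>\<mu>) = (\<Sum>x\<leftarrow>ys. potential \<mu> x)" for ys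
    by (induction ys) (simp_all add: kernel_integrable[OF \<mu>] potential_def)
  note int = int_diag int_sum potential_integrable[OF \<mu> \<mu>]
  \<comment> \<open>On average the two sums over \<open>xs\<close> cancel, and the coefficients
    \<open>- 2 * real (Suc n)\<close> and \<open>2 * real n + 1\<close> of \<open>I\<close> combine
    to -1.\<close>
  have "(\<integral>z. G z \<partial>\<mu>) = (\<integral>z. K z z \<partial>\<mu>) - I"
    unfolding G_def using int
    by (simp add: sum prob_space I_def[symmetric] algebra_simps)
  also have "\<dots> \<le> 2 * M"
    using abs_integral_le[OF \<mu> diag M] iterated_bounded[OF \<mu> \<mu> M] unfolding I_def by linarith
  finally have le: "(\<integral>z. G z \<partial>\<mu>) \<le> 2 * M" .
  \<comment> \<open>A function that exceeds \<open>2 * M\<close> everywhere has mean above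
    \<open>2 * M\<close> under a probability measure.\<close>
  have "\<exists>z. G z \<le> 2 * M"
  proof (rule ccontr)
    assume "\<not> (\<exists>z. G z \<le> 2 * M)"
    then have less: "2 * M < G z" for z by (simp add: not_le)
    have "integrable \<mu> G" unfolding G_def[abs_def] using int by simp
    then have "(\<integral>z. 2 * M \<partial>\<mu>) < (\<integral>z. G z \<partial>\<mu>)"
      using less emeasure_space_1 by (intro integral_less_AE_space) auto
    then show False using le by (simp add: prob_space)
  qed
  then obtain z where "G z \<le> 2 * M" by blast
  then have "F (z # xs) \<le> 2 * M * real (Suc n)"
    using xs(2) by (simp add: F_Cons algebra_simps)
  then show ?case
    using xs(1) unfolding F_def I_def by (intro exI[of _ "z # xs"]) simp
qed

text \<open>The quantity bounded in \<open>greedy_points\<close> is the squared discrepancy times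
  \<open>(real n)\<^sup>2\<close>, so dividing turns \<open>2 * M * real n\<close> into
  \<open>2 * M / real n\<close>.\<close>

lemma empirical_discrepancy:
  assumes \<mu>: "borel_prob \<mu>" and M: "\<And>x y. \<bar>K x y\<bar> \<le> M" and n: "0 < n"
  shows "\<exists>xs. length xs = n \<and> discrepancy K \<mu> (empirical_measure xs) \<le> sqrt (2 * M / real n)"
proof -
  obtain xs where len: "length xs = n" and le: "(\<Sum>x\<leftarrow>xs. \<Sum>y\<leftarrow>xs. K x y) -
      2 * real n * (\<Sum>x\<leftarrow>xs. potential \<mu> x) + (real n)\<^sup>2 * (\<integral>x. potential \<mu> x \<partial>\<mu>) \<le> 2 * M * real n"
    using greedy_points[OF \<mu> M, of n] by auto
  let ?\<nu> = "empirical_measure xs"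
  have ne: "xs \<noteq> []" using len n by auto
  have pot: "potential ?\<nu> = (\<lambda>x. (\<Sum>y\<leftarrow>xs. K x y) / n)"
    unfolding potential_def using integral_empirical_measure[OF ne kernel_measurable] len by simp
  have "(\<integral>x. potential ?\<nu> x \<partial>?\<nu>) = (\<Sum>x\<leftarrow>xs. (\<Sum>y\<leftarrow>xs. K x y) / n) / n"
    by (subst integral_empirical_measure[OF ne potential_measurable[OF borel_prob_empirical_measure]])
      (simp add: pot len)
  also have "\<dots> = (\<Sum>x\<leftarrow>xs. \<Sum>y\<leftarrow>xs. K x y) / (real n)\<^sup>2"
    by (simp add: divide_inverse sum_list_mult_const power2_eq_square)
  finally have 1: "(\<integral>x. potential ?\<nu> x \<partial>?\<nu>) = (\<Sum>x\<leftarrow>xs. \<Sum>y\<leftarrow>xs. K x y) / (real n)\<^sup>2" .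
  have int_sum: "integrable \<mu> (\<lambda>z. \<Sum>x\<leftarrow>ys. K z x)"
    and sum: "(\<integral>z. (\<Sum>x\<leftarrow>ys. K z x) \<partial>\<mu>) = (\<Sum>x\<leftarrow>ys. potential \<mu> x)" for ys
    by (induction ys) (simp_all add: sym[of _ "_::'a"] kernel_integrable[OF \<mu>] potential_def)
  have 2: "(\<integral>x. potential ?\<nu> x \<partial>\<mu>) = (\<Sum>x\<leftarrow>xs. potential \<mu> x) / n"
    unfolding pot by (simp add: sum)
  have "(\<integral>x. potential \<mu> x \<partial>\<mu>) - 2 * (\<integral>x. potential ?\<nu> x \<partial>\<mu>) + (\<integral>x. potential ?\<nu> x \<partial>?\<nu>)
      = ((\<Sum>x\<leftarrow>xs. \<Sum>y\<leftarrow>xs. K x y) - 2 * real n * (\<Sum>x\<leftarrow>xs. potential \<mu> x)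
          + (real n)\<^sup>2 * (\<integral>x. potential \<mu> x \<partial>\<mu>)) / (real n)\<^sup>2"
    unfolding 1 2 using n by (simp add: field_simps power2_eq_square)
  also have "\<dots> \<le> 2 * M * real n / (real n)\<^sup>2"
    using le by (rule divide_right_mono) simp
  also have "\<dots> = 2 * M / real n" using n by (simp add: power2_eq_square)
  finally show ?thesis
    unfolding discrepancy_potential using len by (intro exI[of _ xs]) simp
qed

end

subsection \<open>Short closed curves through many points\<close>

text \<open>The parameter \<open>l\<close> is both the length of the domain and a bound on the
  length of the curve, so concatenation adds the \<open>l\<close> values. Containment of
  \<open>A\<close> in the trace, not equality, leaves room for whatever the path visits in
  between.\<close>

definition lipschitz_path :: "'a::metric_space \<Rightarrow> 'a \<Rightarrow> real \<Rightarrow> 'a set \<Rightarrow> bool" where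
  "lipschitz_path x y l A \<longleftrightarrow> 0 \<le> l \<and>
     (\<exists>g. 1-lipschitz_on {0..l} g \<and> g 0 = x \<and> g l = y \<and> A \<subseteq> g ` {0..l})"

lemma lipschitz_path_const: "0 \<le> l \<Longrightarrow> lipschitz_path x x l {x}"
  unfolding lipschitz_path_def
  by (intro conjI exI[of _ "\<lambda>_. x"]) (auto simp: lipschitz_on_def)

text \<open>Parameters on different sides of the junction are compared through \<open>f l\<close>,
  where both pieces take the value \<open>y\<close>.\<close>

lemma lipschitz_path_trans:
  assumes "lipschitz_path x y l A" "lipschitz_path y z m B"
  shows "lipschitz_path x z (l + m) (A \<union> B)"
proof -
  obtain g h where l: "0 \<le> l" and g: "1-lipschitz_on {0..l} g" "g 0 = x" "g l = y" "A \<subseteq> g ` {0..l}"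
    and m: "0 \<le> m" and h: "1-lipschitz_on {0..m} h" "h 0 = y" "h m = z" "B \<subseteq> h ` {0..m}"
    using assms unfolding lipschitz_path_def by blast
  define f where "f u = (if u \<le> l then g u else h (u - l))" for u
  have f2: "f u = h (u - l)" if "l \<le> u" for u
    using that g(3) h(2) by (cases "u = l") (auto simp: f_def)
  have lip1: "dist (f u) (f v) \<le> \<bar>u - v\<bar>" if "0 \<le> u" "u \<le> l" "0 \<le> v" "v \<le> l" for u v
    using lipschitz_onD[OF g(1), of u v] that by (simp add: f_def dist_real_def)
  have lip2: "dist (f u) (f v) \<le> \<bar>u - v\<bar>" if "l \<le> u" "u \<le> l + m" "l \<le> v" "v \<le> l + m" for u v
    using lipschitz_onD[OF h(1), of "u - l" "v - l"] that by (simp add: f2 dist_real_def)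
  have lip: "dist (f u) (f v) \<le> \<bar>u - v\<bar>" if "0 \<le> u" "u \<le> v" "v \<le> l + m" for u v
  proof -
    consider "v \<le> l" | "l \<le> u" | "u \<le> l" "l \<le> v" by linarith
    then show ?thesis
    proof cases
      case 1
      then show ?thesis using lip1[of u v] that by linarith
    next
      case 2
      then show ?thesis using lip2[of u v] that by linarith
    next
      case 3
      then show ?thesis
        using lip1[of u l] lip2[of l v] dist_triangle[of "f u" "f v" "f l"] that l m by linarith
    qed
  qed
  have "1-lipschitz_on {0..l + m} f"
  proof (rule lipschitz_onI)
    fix u v assume "u \<in> {0..l + m}" "v \<in> {0..l + m}"
    then show "dist (f u) (f v) \<le> 1 * dist u v"
      using lip[of u v] lip[of v u] by (cases "u \<le> v") (auto simp: dist_real_def dist_commute)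
  qed simp
  moreover have "f 0 = x" "f (l + m) = z" using g h l m f2 by (auto simp: f_def)
  moreover have "g ` {0..l} \<subseteq> f ` {0..l + m}"
  proof
    fix p assume "p \<in> g ` {0..l}"
    then obtain u where "u \<in> {0..l}" "p = g u" by blast
    then show "p \<in> f ` {0..l + m}" using m by (intro image_eqI[of _ _ u]) (auto simp: f_def)
  qed
  moreover have "h ` {0..m} \<subseteq> f ` {0..l + m}"
  proof
    fix p assume "p \<in> h ` {0..m}"
    then obtain u where "u \<in> {0..m}" "p = h u" by blast
    then show "p \<in> f ` {0..l + m}" using l by (intro image_eqI[of _ _ "l + u"]) (auto simp: f2)
  qed
  ultimately show ?thesis
    unfolding lipschitz_path_def using l m g(4) h(4) by (intro conjI exI[of _ f]) auto
qed

text \<open>The spare length \<open>l' - l\<close> is spent resting at \<open>y\<close>.\<close>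

lemma lipschitz_path_mono:
  assumes "lipschitz_path x y l A" "l \<le> l'" "A' \<subseteq> A"
  shows "lipschitz_path x y l' A'"
proof -
  have "lipschitz_path x y (l + (l' - l)) (A \<union> {y})"
    using assms(2) by (intro lipschitz_path_trans[OF assms(1)] lipschitz_path_const) simp
  then show ?thesis using assms(3) unfolding lipschitz_path_def by auto
qed

text \<open>The infimum of lengths need not be attained, so twice the distance is allowed; for
  distinct points this is strictly above the infimum. The factor 2 only enters the final
  constant.\<close>

lemma length_space_lipschitz_path:
  fixes x y :: "'a::metric_space"
  assumes "length_space TYPE('a)"
  shows "lipschitz_path x y (2 * dist x y) {x, y}"
proof (cases "x = y")
  case True
  then show ?thesis using lipschitz_path_const[of 0 x] by simp
next
  case False
  let ?C = "{curve_length \<gamma> a b | \<gamma> a b. a \<le> b \<and> continuous_on {a..b} \<gamma> \<and> \<gamma> a = x \<and> \<gamma> b = y}"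
  have "Inf ?C = ereal (dist x y)"
    using assms unfolding length_space_def by metis
  also have "\<dots> < ereal (2 * dist x y)" using False by simp
  finally obtain c where "c \<in> ?C" "c < ereal (2 * dist x y)"
    unfolding Inf_less_iff by blast
  then obtain \<gamma> a b where \<gamma>: "a \<le> b" "continuous_on {a..b} \<gamma>" "\<gamma> a = x" "\<gamma> b = y"
      "curve_length \<gamma> a b \<le> ereal (2 * dist x y)" by auto
  from lipschitz_reparametrization[OF \<gamma>(1,2,5)] obtain g where g: "1-lipschitz_on {0..2 * dist x y} g"
      "g 0 = \<gamma> a" "g (2 * dist x y) = \<gamma> b" "g ` {0..2 * dist x y} = \<gamma> ` {a..b}" by metis
  moreover have "{x, y} \<subseteq> \<gamma> ` {a..b}" using \<gamma> by auto
  ultimately show ?thesis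
    unfolding lipschitz_path_def using \<gamma> by (intro conjI exI[of _ g]) auto
qed

section \<open>Closed walks through finite point sets\<close>

fun walk_length :: "'a::metric_space list \<Rightarrow> real" where
  "walk_length (x # y # xs) = dist x y + walk_length (y # xs)"
| "walk_length _ = 0"

lemma walk_length_detour:
  "walk_length (xs @ q # p # q # ys) = walk_length (xs @ q # ys) + 2 * dist p q"
proof (induction xs rule: walk_length.induct)
  case (1 x y xs)
  then show ?case by simp
next
  case "2_1"
  then show ?case by (cases ys) (simp_all add: dist_commute)
next
  case ("2_2" v)
  then show ?case by (cases ys) (simp_all add: dist_commute)
qed

lemma walk_lipschitz_path:
  fixes xs :: "'a::metric_space list"
  assumes "length_space TYPE('a)" "xs \<noteq> []"
  shows "lipschitz_path (hd xs) (last xs) (2 * walk_length xs) (set xs)"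
  using assms(2)
proof (induction xs rule: walk_length.induct)
  case (1 x y xs)
  have "lipschitz_path x (last (y # xs)) (2 * dist x y + 2 * walk_length (y # xs)) ({x, y} \<union> set (y # xs))"
    using lipschitz_path_trans[OF length_space_lipschitz_path[OF assms(1)] "1.IH"] by simp
  then have "lipschitz_path x (last (y # xs)) (2 * walk_length (x # y # xs)) (set (x # y # xs))"
    by (rule lipschitz_path_mono) auto
  then show ?case by simp
next
  case ("2_2" v)
  then show ?case using lipschitz_path_const[of 0 v] by simp
qed simp

text \<open>Disjoint balls around the points of \<open>S\<close> fit into the finite total mass.\<close>
lemma ahlfors_close_pair:
  fixes \<sigma> :: "'a::metric_space measure"
  assumes cpt: "compact (UNIV :: 'a set)" and sets: "sets \<sigma> = sets borel" and "finite_measure \<sigma>"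
    and ahl: "ahlfors_regular \<sigma> d" and d: "d > 0"
  obtains B where "B > 0" "\<And>S :: 'a set. finite S \<Longrightarrow> 2 \<le> card S \<Longrightarrow>
      \<exists>p\<in>S. \<exists>q\<in>S. p \<noteq> q \<and> dist p q \<le> B * real (card S) powr (- (1 / d))"
proof -
  interpret finite_measure \<sigma> by fact
  obtain C where C: "0 < C" "\<And>x r. 0 < r \<Longrightarrow> r \<le> diameter (UNIV :: 'a set) \<Longrightarrow> C * r powr d \<le> measure \<sigma> (cball x r)"
    using ahl unfolding ahlfors_regular_def by blast
  define m where "m = measure \<sigma> (space \<sigma>)"
  have "0 \<le> m" by (simp add: m_def)
  \<comment> \<open>Chosen so that \<open>card S\<close> balls of half the critical distance have
    total mass at least \<open>m + 1\<close>, more than the space holds.\<close>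
  define B where "B = 2 * ((m + 1) / C) powr (1 / d)"
  have B: "B > 0" using C(1) \<open>0 \<le> m\<close> by (simp add: B_def)
  have Bd: "C * (B / 2) powr d = m + 1"
    using C(1) d \<open>0 \<le> m\<close> by (simp add: B_def powr_powr)
  have "\<exists>p\<in>S. \<exists>q\<in>S. p \<noteq> q \<and> dist p q \<le> B * real (card S) powr (- (1 / d))"
    if S: "finite S" "2 \<le> card S" for S :: "'a set"
  proof (rule ccontr)
    define n where "n = card S"
    have n: "0 < n" using S by (simp add: n_def)
    define r where "r = B * real n powr (- (1 / d))"
    have r: "0 < r" using B n by (simp add: r_def)
    assume "\<not> ?thesis"
    then have far: "r < dist p q" if "p \<in> S" "q \<in> S" "p \<noteq> q" for p q
      using that unfolding r_def n_def by (auto simp: not_le)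
    \<comment> \<open>A far pair shows that \<open>r / 2\<close> is at most the diameter, the range
      in which the Ahlfors lower bound is available.\<close>
    obtain p q where "p \<in> S" "q \<in> S" "p \<noteq> q"
      using S by (metis card_le_Suc0_iff_eq not_less_eq_eq numeral_2_eq_2)
    then have "r < dist p q" using far by blast
    also have "dist p q \<le> diameter (UNIV :: 'a set)"
      using compact_imp_bounded[OF cpt] by (rule diameter_bounded_bound) auto
    finally have diam: "r / 2 \<le> diameter (UNIV :: 'a set)" using r by simp
    have rd: "C * (r / 2) powr d = (m + 1) / n"
    proof -
      have "(r / 2) powr d = (B / 2) powr d * (real n powr (- (1 / d))) powr d"
        using B by (simp add: r_def powr_mult flip: times_divide_eq_left)
      also have "(real n powr (- (1 / d))) powr d = 1 / real n"
        unfolding powr_powr using d n by (simp add: powr_minus_divide)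
      finally have "C * (r / 2) powr d = C * (B / 2) powr d * (1 / real n)" by simp
      then show ?thesis unfolding Bd by simp
    qed
    have disj: "disjoint_family_on (\<lambda>x. cball x (r / 2)) S"
      unfolding disjoint_family_on_def
    proof (intro ballI impI)
      fix p q assume "p \<in> S" "q \<in> S" "p \<noteq> q"
      then have "r < dist p q" by (rule far)
      then have "\<not> (dist p x \<le> r / 2 \<and> dist q x \<le> r / 2)" for x
        using dist_triangle2[of p q x] by linarith
      then show "cball p (r / 2) \<inter> cball q (r / 2) = {}" by auto
    qed
    have "m + 1 = (\<Sum>x\<in>S. (m + 1) / n)" using n by (simp add: n_def)
    also have "\<dots> \<le> (\<Sum>x\<in>S. measure \<sigma> (cball x (r / 2)))"
      unfolding rd[symmetric] using r diam by (intro sum_mono C(2)) auto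
    also have "\<dots> = measure \<sigma> (\<Union>x\<in>S. cball x (r / 2))"
      by (rule finite_measure_finite_Union[OF S(1) _ disj, symmetric]) (simp add: sets image_subset_iff)
    also have "\<dots> \<le> m" unfolding m_def by (rule bounded_measure)
    finally show False by simp
  qed
  then show ?thesis using that B by blast
qed

text \<open>Weighted AM-GM applied to \<open>real (n - 1) powr s * real n powr (1 - s)\<close>, then
  multiplied by \<open>real n powr (s - 1)\<close>. It turns the sum of the detour costs into a
  telescoping sum.\<close>

lemma powr_increment_ge:
  assumes "0 < s" "s < 1" "1 \<le> n"
  shows "s * real n powr (s - 1) \<le> real n powr s - real (n - 1) powr s"
proof (cases "n = 1")
  case False
  then have n: "1 < n" using assms by simp
  have "real (n - 1) powr s * real n powr (1 - s) \<le> s * real (n - 1) + (1 - s) * real n"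
    using assms n by (intro Youngs_inequality_0) auto
  also have "\<dots> = real n - s" using assms by (simp add: algebra_simps)
  finally have "real (n - 1) powr s * real n powr (1 - s) * real n powr (s - 1) \<le> (real n - s) * real n powr (s - 1)"
    by (rule mult_right_mono) simp
  moreover have "real n powr (1 - s) * real n powr (s - 1) = 1"
    using n by (simp flip: powr_add)
  moreover have "real n * real n powr (s - 1) = real n powr s"
    using n by (simp add: powr_mult_base)
  ultimately show ?thesis unfolding mult.assoc left_diff_distrib by simp
qed (use assms in simp)

text \<open>Remove one point of a closest pair, take a closed walk through the remaining points, and insert
  a detour from the other point of the pair.\<close>
lemma closed_walk_through_points:
  assumes d: "d > 1" and B: "B > 0"
    and close: "\<And>S :: 'a::metric_space set. finite S \<Longrightarrow> 2 \<le> card S \<Longrightarrow>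
      \<exists>p\<in>S. \<exists>q\<in>S. p \<noteq> q \<and> dist p q \<le> B * real (card S) powr (- (1 / d))"
    and S: "finite S" "S \<noteq> {}"
  shows "\<exists>xs :: 'a list. xs \<noteq> [] \<and> hd xs = last xs \<and> S \<subseteq> set xs \<and>
    walk_length xs \<le> 2 * B / (1 - 1 / d) * (real (card S) powr (1 - 1 / d) - 1)"
  using S
proof (induction "card S" arbitrary: S rule: less_induct)
  case less
  define s where "s = 1 - 1 / d"
  have s: "0 < s" "s < 1" using d by (simp_all add: s_def)
  show ?case
  proof (cases "2 \<le> card S")
    case False
    then have "card S = 1" using less.prems card_gt_0_iff[of S] by linarith
    then obtain x where "S = {x}" by (rule card_1_singletonE)
    then show ?thesis by (intro exI[of _ "[x]"]) simp
  next
    case True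
    obtain p q where pq: "p \<in> S" "q \<in> S" "p \<noteq> q" "dist p q \<le> B * real (card S) powr (- (1 / d))"
      using close[OF less.prems(1) True] by blast
    have card: "card (S - {p}) = card S - 1" using pq by simp
    have "card (S - {p}) < card S" "finite (S - {p})" "S - {p} \<noteq> {}"
      using less.prems pq True card by auto
    from less.hyps[OF this] obtain xs where xs: "xs \<noteq> []" "hd xs = last xs" "S - {p} \<subseteq> set xs"
        "walk_length xs \<le> 2 * B / s * (real (card S - 1) powr s - 1)"
      unfolding card s_def[symmetric] by blast
    obtain ys zs where yz: "xs = ys @ q # zs"
      using xs(3) pq by (metis Diff_iff singletonD split_list subsetD)
    have "walk_length (ys @ q # p # q # zs) = walk_length xs + 2 * dist p q"
      unfolding yz by (rule walk_length_detour)
    also have "2 * dist p q \<le> 2 * B / s * (s * real (card S) powr (s - 1))"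
      using pq(4) s by (simp add: s_def)
    \<comment> \<open>The cost of the detour is at most the growth of the claimed bound from
      \<open>card S - 1\<close> to \<open>card S\<close> points. The bound starts at 0 for a single
      point.\<close>
    also have "\<dots> \<le> 2 * B / s * (real (card S) powr s - real (card S - 1) powr s)"
      using powr_increment_ge[OF s, of "card S"] True s B by (intro mult_left_mono) auto
    finally have "walk_length (ys @ q # p # q # zs) \<le> 2 * B / s * (real (card S) powr s - 1)"
      using xs(4) by (simp add: right_diff_distrib)
    moreover have "hd (ys @ q # p # q # zs) = last (ys @ q # p # q # zs)"
      using xs(2) unfolding yz by (cases ys; cases zs) auto
    moreover have "S \<subseteq> set (ys @ q # p # q # zs)" using xs(3) unfolding yz by auto
    ultimately show ?thesis unfolding s_def[symmetric] by blast
  qed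
qed

lemma empirical_curve_measure:
  fixes xs :: "'a::metric_space list"
  assumes "lipschitz_path x x L (set xs)" "xs \<noteq> []"
  shows "empirical_measure xs \<in> curve_measures L"
proof -
  obtain g where L: "0 \<le> L" and g: "1-lipschitz_on {0..L} g" "g 0 = g L" "set xs \<subseteq> g ` {0..L}"
    using assms(1) unfolding lipschitz_path_def by auto
  have cont: "continuous_on {0..L} g" using g(1) by (rule lipschitz_on_continuous_on)
  have closed: "closed (g ` {0..L})"
    by (intro compact_imp_closed compact_continuous_image cont) simp
  have "measure_support (empirical_measure xs) \<subseteq> g ` {0..L}"
    using borel_prob_empirical_measure null_sets_empirical_measure[OF assms(2) closed g(3)]
    by (intro measure_support_subset closed) (auto simp: borel_prob_def)
  then show ?thesis
    unfolding curve_measures_def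
    using L g(2) cont borel_prob_empirical_measure lipschitz_curve_length[OF g(1) L] by blast
qed

text \<open>With \<open>N\<close> of order \<open>L powr (d / (d - 1))\<close>, a curve of length \<open>L\<close> passes
  through any \<open>N\<close> points.\<close>
lemma (in compact_kernel) curve_discrepancy_rate:
  fixes \<sigma> :: "'a measure"
  assumes "sets \<sigma> = sets borel" "finite_measure \<sigma>" "ahlfors_regular \<sigma> d" "d > 1" "length_space TYPE('a)"
  shows "\<exists>c>0. \<forall>\<mu> L. borel_prob \<mu> \<and> L > 0 \<longrightarrow>
     (\<exists>\<nu>\<in>curve_measures L. discrepancy K \<mu> \<nu> \<le> c * L powr (- (d / (2 * d - 2))))"
proof -
  obtain M where M: "0 < M" "\<And>x y. \<bar>K x y\<bar> \<le> M" using kernel_bounded by metis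
  obtain B where B: "B > 0" and close: "\<And>S :: 'a set. finite S \<Longrightarrow> 2 \<le> card S \<Longrightarrow>
      \<exists>p\<in>S. \<exists>q\<in>S. p \<noteq> q \<and> dist p q \<le> B * real (card S) powr (- (1 / d))"
  proof -
    have "0 < d" using assms(4) by simp
    from ahlfors_close_pair[OF cpt assms(1-3) this] show ?thesis using that by blast
  qed
  define s where "s = 1 - 1 / d"
  have s: "0 < s" using assms(4) by (simp add: s_def)
  \<comment> \<open>The walk bound \<open>2 * B / s\<close>, doubled because a walk becomes a
    Lipschitz path of twice its length.\<close>
  define A where "A = 4 * B / s"
  have A: "0 < A" using B s by (simp add: A_def)
  \<comment> \<open>\<open>4 * M\<close> is \<open>2 * M\<close> with the factor 2 lost in rounding
    \<open>P\<close> to \<open>N\<close>; the power of \<open>A\<close> is left over when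
    \<open>L\<close> is split off from \<open>1 / sqrt P\<close>.\<close>
  define c where "c = sqrt (4 * M) * A powr (d / (2 * d - 2))"
  have rate: "\<exists>\<nu>\<in>curve_measures L. discrepancy K \<mu> \<nu> \<le> c * L powr (- (d / (2 * d - 2)))"
    if \<mu>: "borel_prob \<mu>" and L: "0 < L" for \<mu> L
  proof -
    \<comment> \<open>The real solution of \<open>A * P powr s = L\<close>, since
      \<open>d / (d - 1)\<close> is \<open>1 / s\<close>. Rounding down keeps the curve short
      enough, and the floor value 1 keeps the list of points nonempty and gives
      \<open>P \<le> 2 * real N\<close>.\<close>
    define P where "P = (L / A) powr (d / (d - 1))"
    define N where "N = max 1 (nat \<lfloor>P\<rfloor>)"
    have P: "0 < P" using L A by (simp add: P_def)
    have N: "0 < N" "P \<le> 2 * real N" unfolding N_def using P by linarith+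
    have AN: "A * (real N powr s - 1) \<le> L"
    \<comment> \<open>For \<open>N = 1\<close> the rounding may have gone up, but the
      \<open>- 1\<close> in the walk bound makes the left side 0, so every positive \<open>L\<close>
      suffices.\<close>
    proof (cases "N = 1")
      case True
      then show ?thesis using L by simp
    next
      case False
      then have "real N \<le> P" unfolding N_def using P by linarith
      then have "real N powr s \<le> P powr s" using s by (intro powr_mono2) auto
      also have "\<dots> = L / A"
        using assms(4) L A by (simp add: P_def powr_powr s_def field_simps)
      finally have "real N powr s \<le> L / A" .
      then have "A * real N powr s \<le> L" using A by (simp add: field_simps)
      then show ?thesis using A by (simp add: right_diff_distrib)
    qed
    obtain xs where xs: "length xs = N" "discrepancy K \<mu> (empirical_measure xs) \<le> sqrt (2 * M / real N)"
      using empirical_discrepancy[OF \<mu> M(2) N(1)] by blast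
    have ne: "xs \<noteq> []" using xs(1) N(1) by auto
    obtain ys where ys: "ys \<noteq> []" "hd ys = last ys" "set xs \<subseteq> set ys"
        "walk_length ys \<le> 2 * B / s * (real (card (set xs)) powr s - 1)"
      using closed_walk_through_points[OF assms(4) B close, of "set xs"] ne unfolding s_def by auto
    have "2 * walk_length ys \<le> A * (real (card (set xs)) powr s - 1)"
      using ys(4) by (simp add: A_def)
    \<comment> \<open>The greedy points may repeat, so the set can have fewer than \<open>N\<close>
      elements.\<close>
    also have "\<dots> \<le> A * (real N powr s - 1)"
      using A s card_length[of xs] xs(1) by (intro mult_left_mono diff_right_mono powr_mono2) auto
    also have "\<dots> \<le> L" by (rule AN)
    finally have "lipschitz_path (last ys) (last ys) L (set xs)"
      using lipschitz_path_mono[OF walk_lipschitz_path[OF assms(5) ys(1)] _ ys(3)] ys(2) by simp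
    then have "empirical_measure xs \<in> curve_measures L"
      using ne by (rule empirical_curve_measure)
    moreover have "sqrt (2 * M / real N) \<le> c * L powr (- (d / (2 * d - 2)))"
    proof -
      have "2 * M / real N \<le> 4 * M / P"
        using N P M(1) by (simp add: field_simps)
      then have "sqrt (2 * M / real N) \<le> sqrt (4 * M) * (1 / sqrt P)"
        by (simp flip: real_sqrt_divide)
      also have "sqrt P = (L / A) powr (d / (2 * d - 2))"
        using assms(4) L A P unfolding P_def by (simp add: powr_powr field_simps flip: powr_half_sqrt)
      also have "1 / \<dots> = A powr (d / (2 * d - 2)) * L powr (- (d / (2 * d - 2)))"
        using L A by (simp add: powr_divide powr_minus_divide)
      finally show ?thesis by (simp add: c_def)
    qed
    ultimately show ?thesis using xs(2) by (meson order_trans)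
  qed
  moreover have "0 < c" using M A by (simp add: c_def)
  ultimately show ?thesis by blast
qed

text \<open>The minimum is expressed by two existence statements: the first says that it is
  attained, the second exhibits a competitor below the rate, so the minimal value is below it too.
  The constant is fixed before \<open>\<mu>\<close> and \<open>L\<close>.\<close>

theorem theorem1:
  fixes \<sigma> :: "'a::metric_space measure" and d :: real and K :: "'a \<Rightarrow> 'a \<Rightarrow> real"
  assumes "compact (UNIV :: 'a set)"
    and "sets \<sigma> = sets borel" and "finite_measure \<sigma>"
    and "measure_support \<sigma> = UNIV"
    and "ahlfors_regular \<sigma> d" and "d > 1"
    and "length_space TYPE('a)"
    and "continuous_on UNIV (\<lambda>(x, y). K x y)"
    and "pos_def_kernel K"
  shows "\<exists>c>0. \<forall>\<mu> L. borel_prob \<mu> \<and> L \<ge> 1 \<longrightarrow>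
           (\<exists>\<nu>\<in>curve_measures L. \<forall>\<nu>'\<in>curve_measures L.
              discrepancy K \<mu> \<nu> \<le> discrepancy K \<mu> \<nu>') \<and>
           (\<exists>\<nu>\<in>curve_measures L. discrepancy K \<mu> \<nu> \<le> c * L powr (- (d / (2 * d - 2))))"
proof -
  interpret compact_kernel K
    by unfold_locales (use assms(1,8,9) in \<open>auto simp: pos_def_kernel_def\<close>)
  obtain c where "c > 0" and rate: "\<And>\<mu> L. borel_prob \<mu> \<Longrightarrow> L > 0 \<Longrightarrow>
      \<exists>\<nu>\<in>curve_measures L. discrepancy K \<mu> \<nu> \<le> c * L powr (- (d / (2 * d - 2)))"
    using curve_discrepancy_rate[OF assms(2,3,5,6,7)] by blast
  then show ?thesis
    using discrepancy_attains_min by (intro exI[of _ c] conjI allI impI) auto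
qed

end
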